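(* Let $M$ be a semisimple left $\mathcal D$-module on which $\nabla$ acts semisimply, and assume that $\delta(\ell(M))=M$, i.e. $\mathcal D\cdot \ell(M)=M$. Then $\ell:\mathrm{Mod}_{\mathcal D}(M)\to \mathrm{Mod}_{\mathcal R}(\ell(M))$, $N\mapsto \ell(N)$, is an isomorphism of categories, with inverse $\delta:\mathrm{Mod}_{\mathcal R}(\ell(M))\to \mathrm{Mod}_{\mathcal D}(M)$, $V\mapsto \mathcal D V$.
   Context: $\mathcal D$ is an associative unital $\mathbb C$-algebra with an element $\nabla\in\mathcal D$ whose adjoint action $P\mapsto[\nabla,P]$ is semisimple with integer eigenvalues, giving a grading $\mathcal D=\bigoplus_{n\in\mathbb Z}\mathcal D(n)$, $\mathcal D(n)=\{P:[\nabla,P]=nP\}$. Put $\mathcal D^-=\bigoplus_{n<0}\mathcal D(n)$, $\mathcal D^0=\mathcal D(0)$, $\mathcal D^+=\bigoplus_{n>0}\mathcal D(n)$, and $\mathcal R=\mathcal D^0/(\mathcal D^0\cap \mathcal D\mathcal D^-)$, where $\mathcal D\mathcal D^-$ is the left ideal generated by $\mathcal D^-$ (so $\mathcal D^0\cap\mathcal D\mathcal D^-$ is a two-sided ideal of $\mathcal D^0$). For a module $M$ over a ring $R$, $\mathrm{Mod}_R(M)$ is the category whose objects are all $R$-submodules of $M$ and whose morphisms are all $R$-module homomorphisms between them. For a $\mathcal D$-module $N$, $\ell(N)=\mathrm{Hom}_{\mathcal D}(\mathcal D/\mathcal D\mathcal D^-,N)=\{n\in N: \mathcal D^-n=0\}$,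 which is an $\mathcal R$-module; on morphisms $\ell$ is restriction. For an $\mathcal R$-submodule $V\subset \ell(M)$, $\delta(V)=\mathcal D V\subset M$, the image of $\mathcal D/\mathcal D\mathcal D^-\otimes_{\mathcal R}V\to M$. *)

theory Defs
  imports Complex_Main "HOL-Algebra.Module" "HOL-Algebra.QuotRing" "HOL-Algebra.Subrings"
begin

section \<open>Left modules over a noncommutative ring\<close>

text \<open>
  The locale \<^locale>\<open>module\<close> of the library requires a commutative ring of scalars; its record type
  and \<^locale>\<open>submodule\<close> do not. The fields \<^const>\<open>mult\<close> and \<^const>\<open>one\<close> of a module are never used.
\<close>

locale left_module = R?: ring R + M?: abelian_group M
  for R :: "('r, 'e) ring_scheme" (structure) and M :: "('r, 'm, 'f) module_scheme" (structure) +
  assumes smult_closed: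
      "\<lbrakk>a \<in> carrier R; x \<in> carrier M\<rbrakk> \<Longrightarrow> a \<odot>\<^bsub>M\<^esub> x \<in> carrier M"
    and smult_l_distr:
      "\<lbrakk>a \<in> carrier R; b \<in> carrier R; x \<in> carrier M\<rbrakk> \<Longrightarrow>
        (a \<oplus> b) \<odot>\<^bsub>M\<^esub> x = a \<odot>\<^bsub>M\<^esub> x \<oplus>\<^bsub>M\<^esub> b \<odot>\<^bsub>M\<^esub> x"
    and smult_r_distr:
      "\<lbrakk>a \<in> carrier R; x \<in> carrier M; y \<in> carrier M\<rbrakk> \<Longrightarrow>
        a \<odot>\<^bsub>M\<^esub> (x \<oplus>\<^bsub>M\<^esub> y) = a \<odot>\<^bsub>M\<^esub> x \<oplus>\<^bsub>M\<^esub> a \<odot>\<^bsub>M\<^esub> y"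
    and smult_assoc:
      "\<lbrakk>a \<in> carrier R; b \<in> carrier R; x \<in> carrier M\<rbrakk> \<Longrightarrow>
        (a \<otimes> b) \<odot>\<^bsub>M\<^esub> x = a \<odot>\<^bsub>M\<^esub> (b \<odot>\<^bsub>M\<^esub> x)"
    and smult_one:
      "x \<in> carrier M \<Longrightarrow> \<one> \<odot>\<^bsub>M\<^esub> x = x"

definition regular_module :: "('d, 'e) ring_scheme \<Rightarrow> ('d, 'd) module" where
  "regular_module R = \<lparr>carrier = carrier R, mult = mult R, one = one R,
     zero = zero R, add = add R, smult = mult R\<rparr>"

definition left_span :: "('r, 'e) ring_scheme \<Rightarrow> ('r, 'm, 'f) module_scheme \<Rightarrow> 'm set \<Rightarrow> 'm set" where
  "left_span R M S = {\<Oplus>\<^bsub>M\<^esub>i\<in>{..<n}. a i \<odot>\<^bsub>M\<^esub> s i | (n::nat) a s.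
     a \<in> {..<n} \<rightarrow> carrier R \<and> s \<in> {..<n} \<rightarrow> S}"

definition simple_submodule ::
    "('r, 'e) ring_scheme \<Rightarrow> ('r, 'm, 'f) module_scheme \<Rightarrow> 'm set \<Rightarrow> bool" where
  "simple_submodule R M S \<longleftrightarrow> submodule S R M \<and> S \<noteq> {\<zero>\<^bsub>M\<^esub>} \<and>
     (\<forall>T. submodule T R M \<and> T \<subseteq> S \<longrightarrow> T = {\<zero>\<^bsub>M\<^esub>} \<or> T = S)"

text \<open>Semisimple: the sum of all simple submodules is the whole module.\<close>

definition semisimple_module :: "('r, 'e) ring_scheme \<Rightarrow> ('r, 'm, 'f) module_scheme \<Rightarrow> bool" where
  "semisimple_module R M \<longleftrightarrow> left_span R M (\<Union>{S. simple_submodule R M S}) = carrier M"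

text \<open>
  Homomorphisms between submodules \<open>V\<close>, \<open>W\<close> of \<open>M\<close>, as extensional functions, so that equality of
  morphisms \<open>V \<rightarrow> W\<close> is HOL equality.
\<close>

definition module_homs :: "('r, 'e) ring_scheme \<Rightarrow> ('r, 'm, 'f) module_scheme \<Rightarrow>
    'm set \<Rightarrow> 'm set \<Rightarrow> ('m \<Rightarrow> 'm) set" where
  "module_homs R M V W = {f \<in> V \<rightarrow>\<^sub>E W.
     (\<forall>x\<in>V. \<forall>y\<in>V. f (x \<oplus>\<^bsub>M\<^esub> y) = f x \<oplus>\<^bsub>M\<^esub> f y) \<and>
     (\<forall>a\<in>carrier R. \<forall>x\<in>V. f (a \<odot>\<^bsub>M\<^esub> x) = a \<odot>\<^bsub>M\<^esub> f x)}"

section \<open>Categories and isomorphisms of categories\<close>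

text \<open>
  Morphisms do not carry their endpoints, so identities, composition and the action of a functor on
  morphisms take the objects as arguments: \<open>Comp C A B E g f\<close> is \<open>g \<circ> f\<close> for \<open>f : A \<rightarrow> B\<close> and
  \<open>g : B \<rightarrow> E\<close>.
\<close>

record ('o, 'a) cat =
  Obj :: "'o set"
  Hom :: "'o \<Rightarrow> 'o \<Rightarrow> 'a set"
  Ident :: "'o \<Rightarrow> 'a"
  Comp :: "'o \<Rightarrow> 'o \<Rightarrow> 'o \<Rightarrow> 'a \<Rightarrow> 'a \<Rightarrow> 'a"

locale category =
  fixes C :: "('o, 'a) cat"
  assumes Ident_in_Hom: "A \<in> Obj C \<Longrightarrow> Ident C A \<in> Hom C A A"
    and Comp_in_Hom: "\<lbrakk>A \<in> Obj C; B \<in> Obj C; E \<in> Obj C; f \<in> Hom C A B; g \<in> Hom C B E\<rbrakk> \<Longrightarrow>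
      Comp C A B E g f \<in> Hom C A E"
    and Comp_Ident_left: "\<lbrakk>A \<in> Obj C; B \<in> Obj C; f \<in> Hom C A B\<rbrakk> \<Longrightarrow>
      Comp C A B B (Ident C B) f = f"
    and Comp_Ident_right: "\<lbrakk>A \<in> Obj C; B \<in> Obj C; f \<in> Hom C A B\<rbrakk> \<Longrightarrow>
      Comp C A A B f (Ident C A) = f"
    and Comp_assoc: "\<lbrakk>A \<in> Obj C; B \<in> Obj C; E \<in> Obj C; F \<in> Obj C;
        f \<in> Hom C A B; g \<in> Hom C B E; h \<in> Hom C E F\<rbrakk> \<Longrightarrow>
      Comp C A E F h (Comp C A B E g f) = Comp C A B F (Comp C B E F h g) f"

locale cat_functor = source: category C + target: category C'
  for C :: "('o, 'a) cat" and C' :: "('p, 'b) cat" +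
  fixes F\<^sub>o :: "'o \<Rightarrow> 'p" and F\<^sub>m :: "'o \<Rightarrow> 'o \<Rightarrow> 'a \<Rightarrow> 'b"
  assumes map_Obj: "A \<in> Obj C \<Longrightarrow> F\<^sub>o A \<in> Obj C'"
    and map_Hom: "\<lbrakk>A \<in> Obj C; B \<in> Obj C; f \<in> Hom C A B\<rbrakk> \<Longrightarrow> F\<^sub>m A B f \<in> Hom C' (F\<^sub>o A) (F\<^sub>o B)"
    and map_Ident: "A \<in> Obj C \<Longrightarrow> F\<^sub>m A A (Ident C A) = Ident C' (F\<^sub>o A)"
    and map_Comp: "\<lbrakk>A \<in> Obj C; B \<in> Obj C; E \<in> Obj C; f \<in> Hom C A B; g \<in> Hom C B E\<rbrakk> \<Longrightarrow>
      F\<^sub>m A E (Comp C A B E g f) = Comp C' (F\<^sub>o A) (F\<^sub>o B) (F\<^sub>o E) (F\<^sub>m B E g) (F\<^sub>m A B f)"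

text \<open>\<open>F\<close> is an isomorphism of categories with inverse \<open>G\<close>: both composites are identity functors.\<close>

locale cat_isomorphism = F: cat_functor C C' F\<^sub>o F\<^sub>m + G: cat_functor C' C G\<^sub>o G\<^sub>m
  for C :: "('o, 'a) cat" and C' :: "('p, 'b) cat"
    and F\<^sub>o :: "'o \<Rightarrow> 'p" and F\<^sub>m :: "'o \<Rightarrow> 'o \<Rightarrow> 'a \<Rightarrow> 'b"
    and G\<^sub>o :: "'p \<Rightarrow> 'o" and G\<^sub>m :: "'p \<Rightarrow> 'p \<Rightarrow> 'b \<Rightarrow> 'a" +
  assumes GF_Obj: "A \<in> Obj C \<Longrightarrow> G\<^sub>o (F\<^sub>o A) = A"
    and FG_Obj: "X \<in> Obj C' \<Longrightarrow> F\<^sub>o (G\<^sub>o X) = X"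
    and GF_Hom: "\<lbrakk>A \<in> Obj C; B \<in> Obj C; f \<in> Hom C A B\<rbrakk> \<Longrightarrow>
      G\<^sub>m (F\<^sub>o A) (F\<^sub>o B) (F\<^sub>m A B f) = f"
    and FG_Hom: "\<lbrakk>X \<in> Obj C'; Y \<in> Obj C'; h \<in> Hom C' X Y\<rbrakk> \<Longrightarrow>
      F\<^sub>m (G\<^sub>o X) (G\<^sub>o Y) (G\<^sub>m X Y h) = h"

definition Mod_cat :: "('r, 'e) ring_scheme \<Rightarrow> ('r, 'm, 'f) module_scheme \<Rightarrow> ('m set, 'm \<Rightarrow> 'm) cat"
  where "Mod_cat R M = \<lparr>Obj = {N. submodule N R M}, Hom = module_homs R M,
    Ident = (\<lambda>N. restrict (\<lambda>x. x) N), Comp = (\<lambda>A B E g f. compose A g f)\<rparr>"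

section \<open>Complex algebras graded by an adjoint action\<close>

definition complex_field :: "complex ring" where
  "complex_field = \<lparr>carrier = UNIV, mult = (*), one = 1, zero = 0, add = (+)\<rparr>"

locale complex_algebra = ring D + C_mod: module complex_field D
  for D :: "(complex, 'd, 'e) module_scheme" (structure) +
  assumes smult_mult_left:
      "\<lbrakk>x \<in> carrier D; y \<in> carrier D\<rbrakk> \<Longrightarrow> (c \<odot> x) \<otimes> y = c \<odot> (x \<otimes> y)"
    and smult_mult_right:
      "\<lbrakk>x \<in> carrier D; y \<in> carrier D\<rbrakk> \<Longrightarrow> x \<otimes> (c \<odot> y) = c \<odot> (x \<otimes> y)"

definition eigenspace :: "('v, 'e) ring_scheme \<Rightarrow> (complex \<Rightarrow> 'v \<Rightarrow> 'v) \<Rightarrow> ('v \<Rightarrow> 'v) \<Rightarrow> complex \<Rightarrow> 'v set"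
  where "eigenspace V scal T c = {x \<in> carrier V. T x = scal c x}"

text \<open>
  The operator \<open>T\<close> on the complex vector space \<open>V\<close> (only its additive structure is taken from the
  record, the scalar action is \<open>scal\<close>) is semisimple with all eigenvalues in \<open>\<Lambda>\<close>: every vector is a
  finite sum of eigenvectors with eigenvalues in \<open>\<Lambda>\<close>. Such a sum of eigenspaces is automatically
  direct.
\<close>

definition semisimple_operator ::
    "('v, 'e) ring_scheme \<Rightarrow> (complex \<Rightarrow> 'v \<Rightarrow> 'v) \<Rightarrow> ('v \<Rightarrow> 'v) \<Rightarrow> complex set \<Rightarrow> bool" where
  "semisimple_operator V scal T \<Lambda> \<longleftrightarrow>
     (\<forall>x\<in>carrier V. \<exists>S f. finite S \<and> S \<subseteq> \<Lambda> \<and> f \<in> (\<Pi> c\<in>S. eigenspace V scal T c) \<and>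
        x = (\<Oplus>\<^bsub>V\<^esub>c\<in>S. f c))"

definition adjoint :: "('d, 'e) ring_scheme \<Rightarrow> 'd \<Rightarrow> 'd \<Rightarrow> 'd" where
  "adjoint D nabla P = (nabla \<otimes>\<^bsub>D\<^esub> P) \<ominus>\<^bsub>D\<^esub> (P \<otimes>\<^bsub>D\<^esub> nabla)"

locale graded_complex_algebra = complex_algebra D
  for D :: "(complex, 'd, 'e) module_scheme" (structure) +
  fixes nabla :: 'd
  assumes nabla_closed: "nabla \<in> carrier D"
    and adjoint_semisimple: "semisimple_operator D (smult D) (adjoint D nabla) \<int>"

definition homogeneous :: "(complex, 'd, 'e) module_scheme \<Rightarrow> 'd \<Rightarrow> int \<Rightarrow> 'd set" where
  "homogeneous D nabla n = eigenspace D (smult D) (adjoint D nabla) (of_int n)"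

definition D_neg :: "(complex, 'd, 'e) module_scheme \<Rightarrow> 'd \<Rightarrow> 'd set" where
  "D_neg D nabla = {\<Oplus>\<^bsub>D\<^esub>n\<in>S. f n | S f.
     finite S \<and> S \<subseteq> {..<0} \<and> f \<in> (\<Pi> n\<in>S. homogeneous D nabla n)}"

definition D_zero :: "(complex, 'd, 'e) module_scheme \<Rightarrow> 'd \<Rightarrow> 'd set" where
  "D_zero D nabla = homogeneous D nabla 0"

text \<open>The left ideal generated by \<open>D_neg\<close>.\<close>

definition D_D_neg :: "(complex, 'd, 'e) module_scheme \<Rightarrow> 'd \<Rightarrow> 'd set" where
  "D_D_neg D nabla = left_span D (regular_module D) (D_neg D nabla)"

definition R_ring :: "(complex, 'd, 'e) module_scheme \<Rightarrow> 'd \<Rightarrow> 'd set ring" where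
  "R_ring D nabla =
     (D\<lparr>carrier := D_zero D nabla\<rparr>) Quot (D_zero D nabla \<inter> D_D_neg D nabla)"

definition acts_semisimply ::
    "(complex, 'd, 'e) module_scheme \<Rightarrow> 'd \<Rightarrow> ('d, 'm, 'f) module_scheme \<Rightarrow> bool" where
  "acts_semisimply D nabla M \<longleftrightarrow>
     semisimple_operator M (\<lambda>c m. (c \<odot>\<^bsub>D\<^esub> \<one>\<^bsub>D\<^esub>) \<odot>\<^bsub>M\<^esub> m) (\<lambda>m. nabla \<odot>\<^bsub>M\<^esub> m) UNIV"

section \<open>The functors\<close>

definition ell_obj ::
    "(complex, 'd, 'e) module_scheme \<Rightarrow> 'd \<Rightarrow> ('d, 'm, 'f) module_scheme \<Rightarrow> 'm set \<Rightarrow> 'm set" where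
  "ell_obj D nabla M N = {n \<in> N. \<forall>P\<in>D_neg D nabla. P \<odot>\<^bsub>M\<^esub> n = \<zero>\<^bsub>M\<^esub>}"

definition ell_mor :: "(complex, 'd, 'e) module_scheme \<Rightarrow> 'd \<Rightarrow> ('d, 'm, 'f) module_scheme \<Rightarrow>
    'm set \<Rightarrow> 'm set \<Rightarrow> ('m \<Rightarrow> 'm) \<Rightarrow> 'm \<Rightarrow> 'm" where
  "ell_mor D nabla M N N' f = restrict f (ell_obj D nabla M N)"

text \<open>
  The module of lowest weight vectors of \<open>M\<close>, over \<open>R_ring\<close>: a coset acts through any of its
  representatives.
\<close>

definition ell_module ::
    "(complex, 'd, 'e) module_scheme \<Rightarrow> 'd \<Rightarrow> ('d, 'm, 'f) module_scheme \<Rightarrow> ('d set, 'm) module" where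
  "ell_module D nabla M = \<lparr>carrier = ell_obj D nabla M (carrier M), mult = mult M, one = one M,
     zero = zero M, add = add M, smult = (\<lambda>X m. the_elem ((\<lambda>P. P \<odot>\<^bsub>M\<^esub> m) ` X))\<rparr>"

definition delta_obj :: "(complex, 'd, 'e) module_scheme \<Rightarrow> ('d, 'm, 'f) module_scheme \<Rightarrow>
    'm set \<Rightarrow> 'm set" where
  "delta_obj D M V = left_span D M V"

text \<open>
  On morphisms, the map induced by \<open>id \<otimes> f\<close> on the images of the tensor products in \<open>M\<close>, sending
  \<open>\<Sum>i. P i v i\<close> to \<open>\<Sum>i. P i (f (v i))\<close>.
\<close>

definition delta_mor :: "(complex, 'd, 'e) module_scheme \<Rightarrow> ('d, 'm, 'f) module_scheme \<Rightarrow>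
    'm set \<Rightarrow> 'm set \<Rightarrow> ('m \<Rightarrow> 'm) \<Rightarrow> 'm \<Rightarrow> 'm" where
  "delta_mor D M V W f = restrict (\<lambda>x. THE y. \<exists>(n::nat) P v.
     P \<in> {..<n} \<rightarrow> carrier D \<and> v \<in> {..<n} \<rightarrow> V \<and>
     x = (\<Oplus>\<^bsub>M\<^esub>i\<in>{..<n}. P i \<odot>\<^bsub>M\<^esub> v i) \<and>
     y = (\<Oplus>\<^bsub>M\<^esub>i\<in>{..<n}. P i \<odot>\<^bsub>M\<^esub> f (v i))) (delta_obj D M V)"

section \<open>Well-definedness\<close>

text \<open>
  The quotient \<^const>\<open>R_ring\<close> is taken by a two-sided ideal (\<open>zero_part_ideal\<close> below) and is a ring,
  and \<^const>\<open>ell_module\<close> is a left module over it (\<open>ell_module_is_left_module\<close>).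
\<close>

lemma (in left_module) smult_l_null: "x \<in> carrier M \<Longrightarrow> \<zero> \<odot>\<^bsub>M\<^esub> x = \<zero>\<^bsub>M\<^esub>"
  by (metis M.add.l_cancel_one M.add.l_cancel_one' R.l_zero R.zero_closed smult_closed smult_l_distr)

lemma (in left_module) smult_r_null: "a \<in> carrier R \<Longrightarrow> a \<odot>\<^bsub>M\<^esub> \<zero>\<^bsub>M\<^esub> = \<zero>\<^bsub>M\<^esub>"
  by (metis M.add.l_cancel_one M.l_zero M.zero_closed smult_closed smult_r_distr)

lemma (in left_module) smult_l_minus:
  assumes "x \<in> carrier M" shows "(\<ominus> \<one>) \<odot>\<^bsub>M\<^esub> x = \<ominus>\<^bsub>M\<^esub> x"
proof -
  have "x \<oplus>\<^bsub>M\<^esub> (\<ominus> \<one>) \<odot>\<^bsub>M\<^esub> x = (\<one> \<oplus> \<ominus> \<one>) \<odot>\<^bsub>M\<^esub> x"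
    using assms by (subst smult_l_distr) (auto simp: smult_one)
  also have "\<dots> = \<zero>\<^bsub>M\<^esub>" using assms by (simp add: R.r_neg smult_l_null)
  finally show ?thesis using assms
    by (metis M.add.inv_equality M.add.m_comm R.a_inv_closed R.one_closed smult_closed)
qed

lemma (in left_module) submodule_iff:
  "submodule N R M \<longleftrightarrow> N \<subseteq> carrier M \<and> \<zero>\<^bsub>M\<^esub> \<in> N \<and> (\<forall>x\<in>N. \<forall>y\<in>N. x \<oplus>\<^bsub>M\<^esub> y \<in> N) \<and>
     (\<forall>a\<in>carrier R. \<forall>x\<in>N. a \<odot>\<^bsub>M\<^esub> x \<in> N)"  (is "_ \<longleftrightarrow> ?r")
proof
  assume "submodule N R M"
  then interpret N: submodule N R M .
  show ?r using N.subset N.one_closed N.m_closed N.smult_closed by auto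
next
  assume r: ?r
  have "\<ominus>\<^bsub>M\<^esub> x \<in> N" if "x \<in> N" for x
  proof -
    have "(\<ominus> \<one>) \<odot>\<^bsub>M\<^esub> x \<in> N" using r that R.a_inv_closed R.one_closed by blast
    then show ?thesis using smult_l_minus[of x] r that by (metis subsetD)
  qed
  then show "submodule N R M"
    using r by unfold_locales (auto simp: a_inv_def)
qed

lemma (in left_module) finsum_smult:
  "\<lbrakk>finite A; a \<in> carrier R; f \<in> A \<rightarrow> carrier M\<rbrakk> \<Longrightarrow>
    a \<odot>\<^bsub>M\<^esub> (\<Oplus>\<^bsub>M\<^esub>i\<in>A. f i) = (\<Oplus>\<^bsub>M\<^esub>i\<in>A. a \<odot>\<^bsub>M\<^esub> f i)"
proof (induction A rule: finite_induct)
  case (insert x F)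
  then have "f x \<in> carrier M" "f \<in> F \<rightarrow> carrier M" by auto
  moreover have "(\<lambda>i. a \<odot>\<^bsub>M\<^esub> f i) \<in> F \<rightarrow> carrier M" using insert by (auto intro: smult_closed)
  ultimately show ?case using insert by (simp add: smult_r_distr smult_closed)
qed (simp add: smult_r_null)

lemma (in left_module) left_span_submodule:
  assumes S: "S \<subseteq> carrier M" shows "submodule (left_span R M S) R M"
  unfolding submodule_iff
proof (intro conjI ballI subsetI)
  fix x assume "x \<in> left_span R M S"
  then show "x \<in> carrier M" unfolding left_span_def using S
    by (force intro!: M.finsum_closed smult_closed)
next
  have "\<zero>\<^bsub>M\<^esub> = (\<Oplus>\<^bsub>M\<^esub>i\<in>{..<0::nat}. undefined i \<odot>\<^bsub>M\<^esub> undefined i)" by simp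
  then show "\<zero>\<^bsub>M\<^esub> \<in> left_span R M S" unfolding left_span_def by blast
next
  fix b x assume b: "b \<in> carrier R" and "x \<in> left_span R M S"
  then obtain n :: nat and a s where x: "a \<in> {..<n} \<rightarrow> carrier R" "s \<in> {..<n} \<rightarrow> S"
      "x = (\<Oplus>\<^bsub>M\<^esub>i\<in>{..<n}. a i \<odot>\<^bsub>M\<^esub> s i)"
    unfolding left_span_def by auto
  have "b \<odot>\<^bsub>M\<^esub> x = (\<Oplus>\<^bsub>M\<^esub>i\<in>{..<n}. b \<odot>\<^bsub>M\<^esub> (a i \<odot>\<^bsub>M\<^esub> s i))"
    unfolding x by (rule finsum_smult) (use x b S in \<open>auto intro!: smult_closed\<close>)
  also have "\<dots> = (\<Oplus>\<^bsub>M\<^esub>i\<in>{..<n}. (b \<otimes> a i) \<odot>\<^bsub>M\<^esub> s i)"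
    by (rule M.finsum_cong') (use x b S in \<open>auto intro!: smult_closed smult_assoc[symmetric] simp: Pi_iff subset_iff\<close>)
  finally show "b \<odot>\<^bsub>M\<^esub> x \<in> left_span R M S"
    unfolding left_span_def using x b by (auto intro!: exI[of _ n] exI[of _ "\<lambda>i. b \<otimes> a i"] exI[of _ s])
next
  fix x y assume "x \<in> left_span R M S" "y \<in> left_span R M S"
  then obtain n m :: nat and a s a' s' where
    x: "a \<in> {..<n} \<rightarrow> carrier R" "s \<in> {..<n} \<rightarrow> S" "x = (\<Oplus>\<^bsub>M\<^esub>i\<in>{..<n}. a i \<odot>\<^bsub>M\<^esub> s i)" and
    y: "a' \<in> {..<m} \<rightarrow> carrier R" "s' \<in> {..<m} \<rightarrow> S" "y = (\<Oplus>\<^bsub>M\<^esub>i\<in>{..<m}. a' i \<odot>\<^bsub>M\<^esub> s' i)"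
    unfolding left_span_def by auto
  define b where "b = (\<lambda>i. if i < n then a i else a' (i - n))"
  define t where "t = (\<lambda>i. if i < n then s i else s' (i - n))"
  have bt: "b \<in> {..<n+m} \<rightarrow> carrier R" "t \<in> {..<n+m} \<rightarrow> S"
    unfolding b_def t_def using x y by (auto simp: Pi_iff)
  have c: "(\<lambda>i. b i \<odot>\<^bsub>M\<^esub> t i) \<in> {..<n+m} \<rightarrow> carrier M"
    using bt S by (auto intro!: smult_closed)
  have "(\<Oplus>\<^bsub>M\<^esub>i\<in>{..<n} \<union> {n..<n+m}. b i \<odot>\<^bsub>M\<^esub> t i) = (\<Oplus>\<^bsub>M\<^esub>i\<in>{..<n}. b i \<odot>\<^bsub>M\<^esub> t i) \<oplus>\<^bsub>M\<^esub> (\<Oplus>\<^bsub>M\<^esub>i\<in>{n..<n+m}. b i \<odot>\<^bsub>M\<^esub> t i)"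
    by (rule M.finsum_Un_disjoint) (use c in auto)
  also have "(\<Oplus>\<^bsub>M\<^esub>i\<in>{..<n}. b i \<odot>\<^bsub>M\<^esub> t i) = x" unfolding x
    by (rule M.finsum_cong') (use x S in \<open>auto simp: b_def t_def intro!: smult_closed\<close>)
  also have "(\<Oplus>\<^bsub>M\<^esub>i\<in>{n..<n+m}. b i \<odot>\<^bsub>M\<^esub> t i) = (\<Oplus>\<^bsub>M\<^esub>i\<in>(\<lambda>i. i + n) ` {..<m}. b i \<odot>\<^bsub>M\<^esub> t i)"
    by (rule arg_cong[of _ _ "finsum M _"]) (auto simp: image_iff Bex_def, presburger)
  also have "(\<Oplus>\<^bsub>M\<^esub>i\<in>(\<lambda>i. i + n) ` {..<m}. b i \<odot>\<^bsub>M\<^esub> t i) = (\<Oplus>\<^bsub>M\<^esub>i\<in>{..<m}. b (i+n) \<odot>\<^bsub>M\<^esub> t (i+n))"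
    by (rule M.finsum_reindex) (use c in \<open>auto simp: inj_on_def\<close>)
  also have "\<dots> = y" unfolding y
    by (rule M.finsum_cong') (use y S in \<open>auto simp: b_def t_def intro!: smult_closed\<close>)
  also have "{..<n} \<union> {n..<n+m} = {..<n+m}" by auto
  finally show "x \<oplus>\<^bsub>M\<^esub> y \<in> left_span R M S"
    unfolding left_span_def using bt by (auto intro!: exI[of _ "n+m"] exI[of _ b] exI[of _ t])
qed

lemma (in left_module) left_span_least:
  assumes N: "submodule N R M" and S: "S \<subseteq> N" shows "left_span R M S \<subseteq> N"
proof -
  have "(\<Oplus>\<^bsub>M\<^esub>i\<in>{..<n}. a i \<odot>\<^bsub>M\<^esub> s i) \<in> N"
    if "a \<in> {..<n} \<rightarrow> carrier R" "s \<in> {..<n} \<rightarrow> S" for n :: nat and a s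
    using that
  proof (induction n)
    case 0 then show ?case using N by (simp add: submodule_iff)
  next
    case (Suc n)
    have "a n \<in> carrier R" "s n \<in> N" using Suc.prems S by (auto simp: Pi_iff)
    then have c: "a n \<odot>\<^bsub>M\<^esub> s n \<in> N" using N unfolding submodule_iff by blast
    have "(\<lambda>i. a i \<odot>\<^bsub>M\<^esub> s i) \<in> {..<n} \<rightarrow> carrier M"
      using Suc.prems S N unfolding submodule_iff
      by (intro funcsetI smult_closed) (auto simp: Pi_iff subset_iff)
    then show ?case using c Suc N unfolding submodule_iff
      by (auto simp: lessThan_Suc Pi_iff subset_iff)
  qed
  then show ?thesis unfolding left_span_def by auto
qed

lemma (in left_module) left_span_superset:
  assumes "S \<subseteq> carrier M" shows "S \<subseteq> left_span R M S"
proof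
  fix x assume x: "x \<in> S"
  have "x = (\<Oplus>\<^bsub>M\<^esub>i\<in>{..<1::nat}. \<one> \<odot>\<^bsub>M\<^esub> x)"
    using x assms by (auto simp: smult_one subset_iff lessThan_Suc)
  then show "x \<in> left_span R M S" unfolding left_span_def using x
    by (auto intro!: exI[of _ "1::nat"] exI[of _ "\<lambda>_. \<one>"] exI[of _ "\<lambda>_. x"])
qed

lemma (in left_module) category_Mod_cat: "category (Mod_cat R M)"
proof
qed (auto simp: Mod_cat_def module_homs_def submodule_iff compose_def fun_eq_iff PiE_iff 
   extensional_def restrict_def)

lemma (in ring) left_module_regular: "left_module R (regular_module R)"
proof -
  have "abelian_group (regular_module R)"
    by (rule abelian_groupI) (auto simp: regular_module_def a_ac intro: add.l_inv_ex)
  then show ?thesis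
    by (intro left_module.intro left_module_axioms.intro ring_axioms)
      (auto simp: regular_module_def l_distr r_distr m_assoc)
qed

context graded_complex_algebra
begin

abbreviation "H \<equiv> homogeneous D nabla"

lemma H_iff: "P \<in> H n \<longleftrightarrow> P \<in> carrier D \<and> nabla \<otimes> P = (of_int n \<odot> P) \<oplus> (P \<otimes> nabla)"
  unfolding homogeneous_def eigenspace_def adjoint_def
  using nabla_closed C_mod.smult_closed[of "of_int n" P]
  by (auto simp: complex_field_def a_minus_def add.inv_solve_right' add.inv_solve_right)

lemma scal_closed[simp]: "x \<in> carrier D \<Longrightarrow> c \<odot> x \<in> carrier D"
  using C_mod.smult_closed[of c x] by (simp add: complex_field_def)

lemma scal_add: "x \<in> carrier D \<Longrightarrow> (a + b) \<odot> x = a \<odot> x \<oplus> b \<odot> x"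
  using C_mod.smult_l_distr[of a b x] by (simp add: complex_field_def)
lemma scal_add2: "x \<in> carrier D \<Longrightarrow> y \<in> carrier D \<Longrightarrow> a \<odot> (x \<oplus> y) = a \<odot> x \<oplus> a \<odot> y"
  using C_mod.smult_r_distr[of a x y] by (simp add: complex_field_def)
lemma scal_0: "x \<in> carrier D \<Longrightarrow> 0 \<odot> x = \<zero>"
  using C_mod.smult_l_null[of x] by (simp add: complex_field_def)
lemma scal_0': "c \<odot> \<zero> = \<zero>"
  using C_mod.smult_r_null[of c] by (simp add: complex_field_def)

lemma H_mult: assumes "P \<in> H m" "Q \<in> H n" shows "P \<otimes> Q \<in> H (m + n)"
proof -
  have c: "P \<in> carrier D" "Q \<in> carrier D" and
    P: "nabla \<otimes> P = (of_int m \<odot> P) \<oplus> (P \<otimes> nabla)" and 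
    Q: "nabla \<otimes> Q = (of_int n \<odot> Q) \<oplus> (Q \<otimes> nabla)" using assms by (auto simp: H_iff)
  have "nabla \<otimes> (P \<otimes> Q) = (nabla \<otimes> P) \<otimes> Q" using c nabla_closed by (simp add: m_assoc)
  also have "\<dots> = (of_int m \<odot> (P \<otimes> Q)) \<oplus> P \<otimes> (nabla \<otimes> Q)"
    unfolding P using c nabla_closed by (simp add: l_distr m_assoc smult_mult_left)
  also have "\<dots> = (of_int m \<odot> (P \<otimes> Q)) \<oplus> ((of_int n \<odot> (P \<otimes> Q)) \<oplus> (P \<otimes> Q) \<otimes> nabla)"
    unfolding Q using c nabla_closed by (simp add: r_distr m_assoc smult_mult_right)
  also have "\<dots> = (of_int (m+n) \<odot> (P \<otimes> Q)) \<oplus> (P \<otimes> Q) \<otimes> nabla"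
    using c nabla_closed by (simp add: scal_add a_assoc)
  finally show ?thesis using c by (simp add: H_iff)
qed

lemma H_zero: "\<zero> \<in> H n" using nabla_closed by (simp add: H_iff scal_0')
lemma H_add: "P \<in> H n \<Longrightarrow> Q \<in> H n \<Longrightarrow> P \<oplus> Q \<in> H n"
  using nabla_closed by (auto simp add: H_iff scal_add2 l_distr r_distr a_ac)

lemma H_minus: assumes "P \<in> H n" shows "\<ominus> P \<in> H n"
proof -
  have "\<ominus> P = (\<ominus> \<one>) \<otimes> P" using assms by (simp add: H_iff l_minus)
  moreover have "\<ominus> \<one> \<in> H 0" using nabla_closed by (auto simp: H_iff scal_0 r_minus l_minus)
  ultimately show ?thesis using H_mult[of "\<ominus> \<one>" 0 P n] assms by simp
qed

lemma D_zero_iff: "P \<in> D_zero D nabla \<longleftrightarrow> P \<in> H 0" by (simp add: D_zero_def)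

lemma D_zero_subring: "subring (D_zero D nabla) D"
  unfolding D_zero_def
proof (rule subringI)
  show "homogeneous D nabla 0 \<subseteq> carrier D" "\<one> \<in> homogeneous D nabla 0"
    by (auto simp: H_iff scal_0 nabla_closed)
qed (use H_mult[of _ 0 _ 0] H_add H_minus in auto)

lemma D_neg_closed: "D_neg D nabla \<subseteq> carrier D"
  unfolding D_neg_def by (auto intro!: finsum_closed simp: H_iff Pi_iff)

lemma D_neg_D_zero: assumes "P \<in> D_neg D nabla" "Q \<in> D_zero D nabla" shows "P \<otimes> Q \<in> D_neg D nabla"
proof -
  obtain S f where S: "finite S" "S \<subseteq> {..<0}" "f \<in> (\<Pi> n\<in>S. H n)" "P = (\<Oplus>n\<in>S. f n)"
    using assms unfolding D_neg_def by auto
  have "P \<otimes> Q = (\<Oplus>n\<in>S. f n \<otimes> Q)" unfolding S(4)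
    by (rule finsum_ldistr) (use S assms in \<open>auto simp: D_zero_def H_iff Pi_iff\<close>)
  moreover have "(\<lambda>n. f n \<otimes> Q) \<in> (\<Pi> n\<in>S. H n)" using S H_mult[of _ _ Q 0] assms by (auto simp: D_zero_iff)
  ultimately show ?thesis unfolding D_neg_def using S by blast
qed

sublocale reg: left_module D "regular_module D" by (rule left_module_regular)

lemma D_D_neg_submodule: "submodule (D_D_neg D nabla) D (regular_module D)"
  unfolding D_D_neg_def by (rule reg.left_span_submodule) (use D_neg_closed in \<open>auto simp: regular_module_def\<close>)

lemma D_D_neg_facts:
  "D_D_neg D nabla \<subseteq> carrier D" "\<zero> \<in> D_D_neg D nabla"
  "x \<in> D_D_neg D nabla \<Longrightarrow> y \<in> D_D_neg D nabla \<Longrightarrow> x \<oplus> y \<in> D_D_neg D nabla"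
  "a \<in> carrier D \<Longrightarrow> y \<in> D_D_neg D nabla \<Longrightarrow> a \<otimes> y \<in> D_D_neg D nabla"
  "D_neg D nabla \<subseteq> D_D_neg D nabla"
  using D_D_neg_submodule D_neg_closed reg.left_span_superset[of "D_neg D nabla"] unfolding reg.submodule_iff
  by (auto simp: regular_module_def D_D_neg_def)

lemma D_D_neg_least:
  assumes "N \<subseteq> carrier D" "\<zero> \<in> N" "\<And>x y. x \<in> N \<Longrightarrow> y \<in> N \<Longrightarrow> x \<oplus> y \<in> N"
    "\<And>a x. a \<in> carrier D \<Longrightarrow> x \<in> N \<Longrightarrow> a \<otimes> x \<in> N" "D_neg D nabla \<subseteq> N"
  shows "D_D_neg D nabla \<subseteq> N"
  unfolding D_D_neg_def
  by (rule reg.left_span_least) (use assms in \<open>auto simp: reg.submodule_iff[unfolded regular_module_def] regular_module_def\<close>)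

lemma D_D_neg_D_zero: assumes "P \<in> D_D_neg D nabla" "Q \<in> D_zero D nabla"
  shows "P \<otimes> Q \<in> D_D_neg D nabla"
proof -
  have Q: "Q \<in> carrier D" using assms by (simp add: D_zero_def H_iff)
  have "D_D_neg D nabla \<subseteq> {x \<in> carrier D. x \<otimes> Q \<in> D_D_neg D nabla}"
    by (rule D_D_neg_least)
      (use Q D_D_neg_facts D_neg_closed D_neg_D_zero assms in \<open>auto simp: l_distr m_assoc\<close>)
  then show ?thesis using assms by auto
qed

abbreviation "D0 \<equiv> D\<lparr>carrier := D_zero D nabla\<rparr>"
abbreviation "II \<equiv> D_zero D nabla \<inter> D_D_neg D nabla"

lemma D_zero_ring: "ring D0"
  using subring_is_ring[OF D_zero_subring] .

lemma zero_part_ideal: "ideal II D0"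
proof -
  interpret D0: ring D0 by (rule D_zero_ring)
  have inv: "\<ominus>\<^bsub>D0\<^esub> x = \<ominus> x" if "x \<in> D_zero D nabla" for x
  proof -
    have "\<ominus>\<^bsub>D0\<^esub> x = \<ominus> x"
      by (rule D0.minus_equality) (use that H_minus[of x 0] in \<open>auto simp: D_zero_iff H_iff[of x] H_iff[of "\<ominus> x"] l_neg\<close>)
    then show ?thesis .
  qed
  have m: "\<ominus> x \<in> D_D_neg D nabla" if "x \<in> D_D_neg D nabla" for x
  proof -
    have "x \<in> carrier D" using that D_D_neg_facts(1) by auto
    then have "\<ominus> x = (\<ominus> \<one>) \<otimes> x" by (simp add: l_minus)
    then show ?thesis using D_D_neg_facts(4)[of "\<ominus> \<one>" x] that by simp
  qed
  show ?thesis
  proof (rule idealI[OF D_zero_ring])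
    have z: "\<zero> \<in> II" using D_D_neg_facts(2) H_zero by (simp add: D_zero_iff)
    have i: "\<ominus>\<^bsub>D0\<^esub> x \<in> II" if "x \<in> II" for x
      using that inv[of x] m[of x] H_minus[of x 0] by (simp add: D_zero_iff)
    have a: "x \<oplus> y \<in> II" if "x \<in> II" "y \<in> II" for x y
      using that D_D_neg_facts(3) H_add by (simp add: D_zero_iff)
    show "subgroup II (add_monoid D0)"
      using z i a by (intro subgroup.intro) (simp_all add: a_inv_def)
  next
    fix a x assume a: "a \<in> II" and "x \<in> carrier D0"
    then have x: "x \<in> D_zero D nabla" by simp
    have xc: "x \<in> carrier D" using x unfolding D_zero_iff H_iff by blast
    have "x \<otimes> a \<in> D_zero D nabla" "a \<otimes> x \<in> D_zero D nabla"
      using subringE(6)[OF D_zero_subring] a x by blast+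
    moreover have "x \<otimes> a \<in> D_D_neg D nabla" "a \<otimes> x \<in> D_D_neg D nabla"
      using D_D_neg_facts(4)[OF xc] D_D_neg_D_zero[OF _ x] a by blast+
    ultimately show "x \<otimes>\<^bsub>D0\<^esub> a \<in> II" "a \<otimes>\<^bsub>D0\<^esub> x \<in> II" by simp_all
  qed
qed

lemma R_ring_is_ring: "ring (R_ring D nabla)"
  unfolding R_ring_def by (rule ideal.quotient_is_ring[OF zero_part_ideal])

lemma ell_module_is_left_module:
  assumes M: "left_module D M"
  shows "left_module (R_ring D nabla) (ell_module D nabla M)"
proof -
  interpret M: left_module D M by fact
  interpret I: ideal II D0 by (rule zero_part_ideal)
  let ?L = "ell_obj D nabla M (carrier M)"
  have ann: "P \<odot>\<^bsub>M\<^esub> m = \<zero>\<^bsub>M\<^esub>" if "m \<in> ?L" "P \<in> D_D_neg D nabla" for P m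
  proof -
    have "m \<in> carrier M" "\<And>P. P \<in> D_neg D nabla \<Longrightarrow> P \<odot>\<^bsub>M\<^esub> m = \<zero>\<^bsub>M\<^esub>" using that by (auto simp: ell_obj_def)
    then have "D_D_neg D nabla \<subseteq> {P \<in> carrier D. P \<odot>\<^bsub>M\<^esub> m = \<zero>\<^bsub>M\<^esub>}"
      by (intro D_D_neg_least)
        (use D_neg_closed in \<open>auto simp: M.smult_l_null M.smult_r_null M.smult_l_distr M.smult_assoc\<close>)
    then show ?thesis using that by auto
  qed
  have act: "smult (ell_module D nabla M) (II +>\<^bsub>D0\<^esub> P) m = P \<odot>\<^bsub>M\<^esub> m"
    if "m \<in> ?L" "P \<in> D_zero D nabla" for P m
  proof -
    have c: "P \<in> carrier D" "m \<in> carrier M" using that by (auto simp: D_zero_def H_iff ell_obj_def)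
    have "(\<lambda>P. P \<odot>\<^bsub>M\<^esub> m) ` (II +>\<^bsub>D0\<^esub> P) = {P \<odot>\<^bsub>M\<^esub> m}"
    proof -
      have 1: "Q \<odot>\<^bsub>M\<^esub> m = P \<odot>\<^bsub>M\<^esub> m" if Q: "Q \<in> II +>\<^bsub>D0\<^esub> P" for Q
      proof -
        from Q obtain h where h: "h \<in> II" "Q = h \<oplus> P" unfolding a_r_coset_def' by auto
        then have "h \<in> carrier D" using D_D_neg_facts(1) by auto
        then show ?thesis using h c ann[OF \<open>m \<in> ?L\<close>, of h] by (simp add: M.smult_l_distr M.smult_closed)
      qed
      have "P \<in> II +>\<^bsub>D0\<^esub> P" using I.a_rcos_self[of P] that by simp
      then have "P \<odot>\<^bsub>M\<^esub> m \<in> (\<lambda>P. P \<odot>\<^bsub>M\<^esub> m) ` (II +>\<^bsub>D0\<^esub> P)" by (rule imageI)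
      moreover have "(\<lambda>P. P \<odot>\<^bsub>M\<^esub> m) ` (II +>\<^bsub>D0\<^esub> P) \<subseteq> {P \<odot>\<^bsub>M\<^esub> m}"
        by (rule image_subsetI) (use 1 in blast)
      ultimately show ?thesis by blast
    qed
    then show ?thesis by (simp add: ell_module_def)
  qed
  have carr: "carrier (R_ring D nabla) = (\<lambda>P. II +>\<^bsub>D0\<^esub> P) ` D_zero D nabla"
    unfolding R_ring_def FactRing_simps by auto
  have L0: "P \<odot>\<^bsub>M\<^esub> m \<in> ?L" if "m \<in> ?L" "P \<in> D_zero D nabla" for P m
  proof -
    have c: "P \<in> carrier D" "m \<in> carrier M" using that by (auto simp: D_zero_def H_iff ell_obj_def)
    have "Q \<odot>\<^bsub>M\<^esub> (P \<odot>\<^bsub>M\<^esub> m) = \<zero>\<^bsub>M\<^esub>" if Q: "Q \<in> D_neg D nabla" for Q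
      using D_neg_D_zero[OF Q \<open>P \<in> D_zero D nabla\<close>] c D_neg_closed Q \<open>m \<in> ?L\<close>
        M.smult_assoc[of Q P m] by (auto simp: ell_obj_def)
    then show ?thesis using c by (simp add: ell_obj_def M.smult_closed)
  qed
  have La: "x \<oplus>\<^bsub>M\<^esub> y \<in> ?L" if "x \<in> ?L" "y \<in> ?L" for x y
    using that D_neg_closed by (auto simp: ell_obj_def M.smult_r_distr subset_iff)
  have Lz: "\<zero>\<^bsub>M\<^esub> \<in> ?L" using D_neg_closed by (auto simp: ell_obj_def M.smult_r_null subset_iff)
  have Lc: "?L \<subseteq> carrier M" by (auto simp: ell_obj_def)
  have mone: "\<ominus> \<one> \<in> D_zero D nabla"
    using D_zero_subring H_minus[of \<one> 0] nabla_closed by (auto simp: D_zero_def H_iff scal_0)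
  have neg: "\<exists>y\<in>?L. y \<oplus>\<^bsub>M\<^esub> x = \<zero>\<^bsub>M\<^esub>" if "x \<in> ?L" for x
    using L0[OF that mone] that Lc M.smult_l_minus[of x] M.M.l_neg[of x] by (auto intro!: bexI[of _ "\<ominus>\<^bsub>M\<^esub> x"])
  have sel: "carrier (ell_module D nabla M) = ?L" "add (ell_module D nabla M) = add M"
     "zero (ell_module D nabla M) = zero M" by (simp_all add: ell_module_def)
  have ab: "abelian_group (ell_module D nabla M)"
    by (rule abelian_groupI) (use La Lz neg Lc in \<open>auto simp: sel subset_iff M.M.a_ac\<close>)
  have addR: "(II +>\<^bsub>D0\<^esub> P) \<oplus>\<^bsub>R_ring D nabla\<^esub> (II +>\<^bsub>D0\<^esub> Q) = II +>\<^bsub>D0\<^esub> (P \<oplus> Q)"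
    if "P \<in> D_zero D nabla" "Q \<in> D_zero D nabla" for P Q
    using I.a_rcos_sum[of P Q] that by (simp add: R_ring_def FactRing_def)
  have multR: "(II +>\<^bsub>D0\<^esub> P) \<otimes>\<^bsub>R_ring D nabla\<^esub> (II +>\<^bsub>D0\<^esub> Q) = II +>\<^bsub>D0\<^esub> (P \<otimes> Q)"
    if "P \<in> D_zero D nabla" "Q \<in> D_zero D nabla" for P Q
    using I.rcoset_mult_add[of P Q] that by (simp add: R_ring_def FactRing_def)
  have oneR: "\<one>\<^bsub>R_ring D nabla\<^esub> = II +>\<^bsub>D0\<^esub> \<one>" by (simp add: R_ring_def FactRing_def)
  have D0c: "P \<in> carrier D" if "P \<in> D_zero D nabla" for P using that by (simp add: D_zero_def H_iff)
  have D0a: "P \<oplus> Q \<in> D_zero D nabla" "P \<otimes> Q \<in> D_zero D nabla" "\<one> \<in> D_zero D nabla"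
    if "P \<in> D_zero D nabla" "Q \<in> D_zero D nabla" for P Q
    using that D_zero_subring by (auto simp: subringE)
  have D01: "\<one> \<in> D_zero D nabla" using D_zero_subring by (auto simp: subringE)
  show ?thesis
  proof (intro left_module.intro left_module_axioms.intro R_ring_is_ring ab, unfold carr sel oneR)
  qed (use L0 La Lc D0c D0a D01 in \<open>auto simp: act addR multR M.smult_l_distr M.smult_r_distr M.smult_assoc M.smult_one subset_iff\<close>)
qed

end
end

theory Submission
  imports Defs
begin

text \<open>
  Write \<open>D\<^sup>+M\<close> for the additive span of all \<open>P m\<close> with \<open>P\<close> homogeneous of positive degree. Everything
  rests on one fact: a lowest weight vector in \<open>D\<^sup>+M\<close> is zero (\<open>lowest_Int_raised\<close>). Indeed, let
  \<open>u\<close> be such a vector. As \<open>M\<close> is semisimple, \<open>Du\<close> has a complement, and projecting an expression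
  of \<open>u\<close> as an element of \<open>D\<^sup>+M\<close> onto \<open>Du\<close> shows \<open>u \<in> D\<^sup>+(Du)\<close>. But negative degrees kill \<open>u\<close>, so
  the weights of \<open>nabla\<close> on \<open>Du\<close> have real part at least \<open>r\<close>, the minimal real part of a weight
  occurring in \<open>u\<close>, and those on \<open>D\<^sup>+(Du)\<close> have real part at least \<open>r + 1\<close>. Hence the components of \<open>u\<close>
  with real part \<open>r\<close> vanish, which is absurd unless \<open>u = 0\<close>.

  On objects: an \<open>R\<close>-submodule \<open>V\<close> of lowest weight vectors satisfies \<open>DV \<subseteq> V + D\<^sup>+M\<close>, and by the
  fact above a lowest weight vector in \<open>V + D\<^sup>+M\<close> lies in \<open>V\<close>; so \<open>\<ell>(DV) = V\<close>. Conversely, if \<open>T\<close>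
  is a complement of a submodule \<open>N\<close>, then \<open>\<ell>(M) = \<ell>(N) \<oplus> \<ell>(T)\<close>, and since \<open>\<ell>(M)\<close> generates \<open>M\<close>,
  also \<open>\<ell>(N)\<close> generates \<open>N\<close> (\<open>delta_ell\<close>).

  On morphisms: what has to be shown is that an \<open>R\<close>-linear \<open>f : V \<rightarrow> W\<close> extends to a \<open>D\<close>-linear map
  \<open>DV \<rightarrow> DW\<close>; the extension is unique because \<open>V\<close> generates \<open>DV\<close>, and uniqueness gives all functor
  laws. The candidate for its graph is the \<open>D\<close>-submodule of \<open>M \<times> M\<close> generated by the graph of
  \<open>f\<close>, and the vectors \<open>y\<close> with \<open>(0, y)\<close> in this submodule form a \<open>D\<close>-submodule \<open>K\<close> of \<open>M\<close>. The
  elements of the generated submodule have the form \<open>(v + p, f v + q)\<close> with \<open>v \<in> V\<close> and \<open>p, q \<in> D\<^sup>+M\<close>;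
  for a lowest weight vector \<open>z = f v + q\<close> of \<open>K\<close> the equation \<open>v + p = 0\<close> forces \<open>v = p = 0\<close>, and then
  \<open>z = q \<in> D\<^sup>+M\<close> is zero. So \<open>\<ell>(K) = 0\<close>, and \<open>K = D \<ell>(K) = 0\<close>: the generated submodule is the
  graph of a map.
\<close>

section \<open>Additive spans and semisimple modules\<close>

inductive_set add_span :: "('a, 'b) ring_scheme \<Rightarrow> 'a set \<Rightarrow> 'a set"
  for M :: "('a, 'b) ring_scheme" (structure) and G :: "'a set" where
  zero: "\<zero> \<in> add_span M G"
| incl: "x \<in> G \<Longrightarrow> x \<in> add_span M G"
| add: "\<lbrakk>x \<in> add_span M G; y \<in> add_span M G\<rbrakk> \<Longrightarrow> x \<oplus> y \<in> add_span M G"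

lemma add_span_least:
  fixes M (structure)
  assumes "\<zero> \<in> N" "\<And>x y. \<lbrakk>x \<in> N; y \<in> N\<rbrakk> \<Longrightarrow> x \<oplus> y \<in> N" "G \<subseteq> N"
  shows "add_span M G \<subseteq> N"
proof
  fix x assume "x \<in> add_span M G"
  then show "x \<in> N" by induction (use assms in auto)
qed

lemma add_span_mono: "G \<subseteq> G' \<Longrightarrow> add_span M G \<subseteq> add_span M G'"
  by (rule add_span_least) (auto intro: add_span.intros)

context abelian_group
begin

lemma add_span_closed: "S \<subseteq> carrier G \<Longrightarrow> add_span G S \<subseteq> carrier G"
  by (rule add_span_least) auto

lemma add_span_finsum:
  "\<lbrakk>finite A; S \<subseteq> carrier G; f \<in> A \<rightarrow> add_span G S\<rbrakk> \<Longrightarrow> finsum G f A \<in> add_span G S"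
proof (induction A rule: finite_induct)
  case (insert x F)
  then have "f x \<in> carrier G" "f \<in> F \<rightarrow> carrier G" using add_span_closed[of S] by auto
  then show ?case using insert by (auto intro: add_span.add)
qed (auto intro: add_span.zero)

lemma add_span_minus:
  assumes S: "S \<subseteq> carrier G" "\<And>x. x \<in> S \<Longrightarrow> \<ominus> x \<in> S" and x: "x \<in> add_span G S"
  shows "\<ominus> x \<in> add_span G S"
  using x
proof induction
  case (add x y)
  then have "x \<in> carrier G" "y \<in> carrier G" using add_span_closed[OF S(1)] by auto
  then show ?case using add by (simp add: minus_add add_span.add)
qed (use S add.inv_one in \<open>auto simp: a_inv_def intro: add_span.intros\<close>)

end

context left_module
begin

lemma submoduleD:
  assumes "submodule N R M"
  shows "x \<in> N \<Longrightarrow> x \<in> carrier M" "\<zero>\<^bsub>M\<^esub> \<in> N" "\<lbrakk>x \<in> N; y \<in> N\<rbrakk> \<Longrightarrow> x \<oplus>\<^bsub>M\<^esub> y \<in> N"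
    "\<lbrakk>a \<in> carrier R; x \<in> N\<rbrakk> \<Longrightarrow> a \<odot>\<^bsub>M\<^esub> x \<in> N" "x \<in> N \<Longrightarrow> \<ominus>\<^bsub>M\<^esub> x \<in> N"
proof -
  show *: "x \<in> N \<Longrightarrow> x \<in> carrier M" "\<zero>\<^bsub>M\<^esub> \<in> N" "\<lbrakk>x \<in> N; y \<in> N\<rbrakk> \<Longrightarrow> x \<oplus>\<^bsub>M\<^esub> y \<in> N"
    "\<And>a. \<lbrakk>a \<in> carrier R; x \<in> N\<rbrakk> \<Longrightarrow> a \<odot>\<^bsub>M\<^esub> x \<in> N"
    using assms unfolding submodule_iff by auto
  show "\<ominus>\<^bsub>M\<^esub> x \<in> N" if "x \<in> N"
    using *(4)[of "\<ominus> \<one>"] smult_l_minus[of x] *(1) that by simp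
qed

lemma smult_r_minus:
  assumes "a \<in> carrier R" "x \<in> carrier M"
  shows "a \<odot>\<^bsub>M\<^esub> (\<ominus>\<^bsub>M\<^esub> x) = \<ominus>\<^bsub>M\<^esub> (a \<odot>\<^bsub>M\<^esub> x)"
proof -
  have "a \<odot>\<^bsub>M\<^esub> (\<ominus>\<^bsub>M\<^esub> x) \<oplus>\<^bsub>M\<^esub> a \<odot>\<^bsub>M\<^esub> x = \<zero>\<^bsub>M\<^esub>"
    using assms by (simp add: smult_r_distr[symmetric] M.l_neg smult_r_null)
  then show ?thesis using assms by (simp add: M.minus_equality smult_closed)
qed

lemma submodule_zero: "submodule {\<zero>\<^bsub>M\<^esub>} R M"
  by (simp add: submodule_iff smult_r_null)

lemma submodule_Int: "\<lbrakk>submodule A R M; submodule B R M\<rbrakk> \<Longrightarrow> submodule (A \<inter> B) R M"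
  by (auto simp: submodule_iff)

lemma set_add_iff: "x \<in> A <+>\<^bsub>M\<^esub> B \<longleftrightarrow> (\<exists>a\<in>A. \<exists>b\<in>B. x = a \<oplus>\<^bsub>M\<^esub> b)"
  by (auto simp: set_add_def set_mult_def)

lemma set_addI: "\<lbrakk>a \<in> A; b \<in> B\<rbrakk> \<Longrightarrow> a \<oplus>\<^bsub>M\<^esub> b \<in> A <+>\<^bsub>M\<^esub> B"
  by (auto simp: set_add_iff)

lemma submodule_set_add:
  assumes A: "submodule A R M" and B: "submodule B R M"
  shows "submodule (A <+>\<^bsub>M\<^esub> B) R M"
  unfolding submodule_iff
proof (intro conjI ballI subsetI)
  note a = submoduleD[OF A] and b = submoduleD[OF B]
  show "x \<in> carrier M" if "x \<in> A <+>\<^bsub>M\<^esub> B" for x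
    using that a(1) b(1) by (auto simp: set_add_iff)
  show "\<zero>\<^bsub>M\<^esub> \<in> A <+>\<^bsub>M\<^esub> B" using set_addI[OF a(2) b(2)] by simp
  show "x \<oplus>\<^bsub>M\<^esub> y \<in> A <+>\<^bsub>M\<^esub> B" if xy: "x \<in> A <+>\<^bsub>M\<^esub> B" "y \<in> A <+>\<^bsub>M\<^esub> B" for x y
  proof -
    obtain a1 b1 a2 b2 where *: "a1 \<in> A" "b1 \<in> B" "a2 \<in> A" "b2 \<in> B"
      "x = a1 \<oplus>\<^bsub>M\<^esub> b1" "y = a2 \<oplus>\<^bsub>M\<^esub> b2" using xy by (auto simp: set_add_iff)
    then have "x \<oplus>\<^bsub>M\<^esub> y = (a1 \<oplus>\<^bsub>M\<^esub> a2) \<oplus>\<^bsub>M\<^esub> (b1 \<oplus>\<^bsub>M\<^esub> b2)"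
      using a(1) b(1) by (simp add: M.a_ac)
    then show ?thesis using set_addI[OF a(3) b(3)] * by simp
  qed
  show "c \<odot>\<^bsub>M\<^esub> x \<in> A <+>\<^bsub>M\<^esub> B" if c: "c \<in> carrier R" and x: "x \<in> A <+>\<^bsub>M\<^esub> B" for c x
  proof -
    obtain a1 b1 where *: "a1 \<in> A" "b1 \<in> B" "x = a1 \<oplus>\<^bsub>M\<^esub> b1" using x by (auto simp: set_add_iff)
    then have "c \<odot>\<^bsub>M\<^esub> x = c \<odot>\<^bsub>M\<^esub> a1 \<oplus>\<^bsub>M\<^esub> c \<odot>\<^bsub>M\<^esub> b1"
      using a(1) b(1) c by (simp add: smult_r_distr)
    then show ?thesis using set_addI[OF a(4) b(4)] * c by simp
  qed
qed

lemma set_add_superset: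
  assumes A: "submodule A R M" and B: "submodule B R M"
  shows "A \<subseteq> A <+>\<^bsub>M\<^esub> B" "B \<subseteq> A <+>\<^bsub>M\<^esub> B"
  using set_addI[of _ A "\<zero>\<^bsub>M\<^esub>" B] set_addI[of "\<zero>\<^bsub>M\<^esub>" A _ B]
    submoduleD(1,2)[OF A] submoduleD(1,2)[OF B] by fastforce+

text \<open>
  Turns statements about left spans into inductions in which only closure under addition is left
  to check.
\<close>

lemma left_span_subset_add_span:
  assumes S: "S \<subseteq> carrier M"
  shows "left_span R M S \<subseteq> add_span M {a \<odot>\<^bsub>M\<^esub> s | a s. a \<in> carrier R \<and> s \<in> S}" (is "_ \<subseteq> add_span M ?G")
proof
  have G: "?G \<subseteq> carrier M" using S by (auto intro!: smult_closed)
  fix x assume "x \<in> left_span R M S"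
  then obtain n :: nat and a s where x: "a \<in> {..<n} \<rightarrow> carrier R" "s \<in> {..<n} \<rightarrow> S"
      "x = (\<Oplus>\<^bsub>M\<^esub>i\<in>{..<n}. a i \<odot>\<^bsub>M\<^esub> s i)"
    unfolding left_span_def by auto
  show "x \<in> add_span M ?G" unfolding x(3)
    by (rule M.add_span_finsum[OF _ G]) (use x in \<open>auto intro!: add_span.incl\<close>)
qed

lemma disjoint_sum_cancel:
  assumes N: "submodule N R M" and T: "submodule T R M" and NT: "N \<inter> T = {\<zero>\<^bsub>M\<^esub>}"
    and a: "a \<in> N" "b \<in> T" "a \<oplus>\<^bsub>M\<^esub> b \<in> N"
  shows "b = \<zero>\<^bsub>M\<^esub>"
proof -
  have "b = \<ominus>\<^bsub>M\<^esub> a \<oplus>\<^bsub>M\<^esub> (a \<oplus>\<^bsub>M\<^esub> b)"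
    using a submoduleD(1)[OF N] submoduleD(1)[OF T] by (simp add: M.r_neg1)
  then have "b \<in> N" using submoduleD(3)[OF N submoduleD(5)[OF N a(1)] a(3)] by simp
  then show ?thesis using NT a by auto
qed

text \<open>
  A complement is a submodule \<open>T\<close> that is maximal among those meeting \<open>N\<close> trivially. A simple
  submodule not contained in \<open>N + T\<close> would meet \<open>N + T\<close> trivially, so that it could be added to \<open>T\<close>;
  hence \<open>N + T\<close> contains all simple submodules.
\<close>

lemma semisimple_complement:
  assumes ss: "semisimple_module R M" and N: "submodule N R M"
  obtains T where "submodule T R M" "N \<inter> T = {\<zero>\<^bsub>M\<^esub>}" "N <+>\<^bsub>M\<^esub> T = carrier M"
proof -
  let ?A = "{T. submodule T R M \<and> N \<inter> T = {\<zero>\<^bsub>M\<^esub>}}"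
  have "\<exists>T\<in>?A. \<forall>X\<in>?A. T \<subseteq> X \<longrightarrow> X = T"
  proof (rule subset_Zorn_nonempty)
    show "?A \<noteq> {}" using submodule_zero submoduleD[OF N] by blast
  next
    fix C assume C: "C \<noteq> {}" "subset.chain ?A C"
    have sub: "submodule X R M" "N \<inter> X = {\<zero>\<^bsub>M\<^esub>}" if "X \<in> C" for X
      using C that by (auto simp: subset_chain_def)
    have "x \<oplus>\<^bsub>M\<^esub> y \<in> \<Union>C" if xy: "x \<in> \<Union>C" "y \<in> \<Union>C" for x y
    proof -
      obtain X Y where "x \<in> X" "y \<in> Y" "X \<in> C" "Y \<in> C" using xy by auto
      moreover from this have "X \<subseteq> Y \<or> Y \<subseteq> X" using C by (auto simp: subset_chain_def)
      ultimately show ?thesis using submoduleD(3)[OF sub(1)] by blast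
    qed
    moreover have "\<Union>C \<subseteq> carrier M" "\<zero>\<^bsub>M\<^esub> \<in> \<Union>C"
      using C(1) submoduleD(1,2)[OF sub(1)] by auto
    moreover have "a \<odot>\<^bsub>M\<^esub> x \<in> \<Union>C" if "a \<in> carrier R" "x \<in> \<Union>C" for a x
      using that submoduleD(4)[OF sub(1)] by blast
    ultimately have "submodule (\<Union>C) R M" unfolding submodule_iff by simp
    moreover have "N \<inter> \<Union>C = {\<zero>\<^bsub>M\<^esub>}" using sub(2) C(1) by blast
    ultimately show "\<Union>C \<in> ?A" by simp
  qed
  then obtain T where TA: "T \<in> ?A" and "\<forall>X\<in>?A. T \<subseteq> X \<longrightarrow> X = T" by (rule bexE)
  then have max: "X = T" if "submodule X R M" "N \<inter> X = {\<zero>\<^bsub>M\<^esub>}" "T \<subseteq> X" for X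
    using that by simp
  have T: "submodule T R M" "N \<inter> T = {\<zero>\<^bsub>M\<^esub>}" using TA by simp_all
  have NT: "submodule (N <+>\<^bsub>M\<^esub> T) R M" using N T(1) by (rule submodule_set_add)
  have "S \<subseteq> N <+>\<^bsub>M\<^esub> T" if S: "simple_submodule R M S" for S
  proof (rule ccontr)
    assume not: "\<not> S \<subseteq> N <+>\<^bsub>M\<^esub> T"
    have S': "submodule S R M" using S by (simp add: simple_submodule_def)
    have "(N <+>\<^bsub>M\<^esub> T) \<inter> S \<noteq> S" using not by blast
    then have meet: "(N <+>\<^bsub>M\<^esub> T) \<inter> S = {\<zero>\<^bsub>M\<^esub>}"
      using S submodule_Int[OF NT S'] unfolding simple_submodule_def by (metis Int_lower2)
    have TS: "submodule (T <+>\<^bsub>M\<^esub> S) R M" using T(1) S' by (rule submodule_set_add)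
    have "n = \<zero>\<^bsub>M\<^esub>" if n: "n \<in> N" "n \<in> T <+>\<^bsub>M\<^esub> S" for n
    proof -
      obtain t s where ts: "t \<in> T" "s \<in> S" "n = t \<oplus>\<^bsub>M\<^esub> s" using n by (auto simp: set_add_iff)
      have "s = \<zero>\<^bsub>M\<^esub>"
        by (rule disjoint_sum_cancel[OF NT S' meet, of t])
          (use ts n set_add_superset[OF N T(1)] in auto)
      then have "n = t" using ts submoduleD(1)[OF T(1)] by simp
      then show ?thesis using ts n T(2) by blast
    qed
    then have "N \<inter> (T <+>\<^bsub>M\<^esub> S) = {\<zero>\<^bsub>M\<^esub>}"
      using submoduleD(2)[OF TS] submoduleD(2)[OF N] by blast
    then have "T <+>\<^bsub>M\<^esub> S = T" using max[OF TS] set_add_superset[OF T(1) S'] by simp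
    then show False using not set_add_superset[OF T(1) S'] set_add_superset[OF N T(1)] by blast
  qed
  then have "\<Union>{S. simple_submodule R M S} \<subseteq> N <+>\<^bsub>M\<^esub> T" by blast
  then have "carrier M \<subseteq> N <+>\<^bsub>M\<^esub> T"
    using left_span_least[OF NT] ss unfolding semisimple_module_def by blast
  then have "N <+>\<^bsub>M\<^esub> T = carrier M" using submoduleD(1)[OF NT] by blast
  then show ?thesis using that T by simp
qed

end

definition module_prod ::
    "('r, 'm, 'f) module_scheme \<Rightarrow> ('r, 'n, 'g) module_scheme \<Rightarrow> ('r, 'm \<times> 'n) module" where
  "module_prod M N = \<lparr>carrier = carrier M \<times> carrier N, mult = (\<lambda>x y. x), one = (\<zero>\<^bsub>M\<^esub>, \<zero>\<^bsub>N\<^esub>),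
     zero = (\<zero>\<^bsub>M\<^esub>, \<zero>\<^bsub>N\<^esub>), add = (\<lambda>(x, y) (x', y'). (x \<oplus>\<^bsub>M\<^esub> x', y \<oplus>\<^bsub>N\<^esub> y')),
     smult = (\<lambda>a (x, y). (a \<odot>\<^bsub>M\<^esub> x, a \<odot>\<^bsub>N\<^esub> y))\<rparr>"

lemma module_prod_simps [simp]:
  "carrier (module_prod M N) = carrier M \<times> carrier N" "\<zero>\<^bsub>module_prod M N\<^esub> = (\<zero>\<^bsub>M\<^esub>, \<zero>\<^bsub>N\<^esub>)"
  "(x, y) \<oplus>\<^bsub>module_prod M N\<^esub> (x', y') = (x \<oplus>\<^bsub>M\<^esub> x', y \<oplus>\<^bsub>N\<^esub> y')"
  "a \<odot>\<^bsub>module_prod M N\<^esub> (x, y) = (a \<odot>\<^bsub>M\<^esub> x, a \<odot>\<^bsub>N\<^esub> y)"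
  by (simp_all add: module_prod_def)

lemma left_module_prod:
  assumes "left_module R M" "left_module R N"
  shows "left_module R (module_prod M N)"
proof -
  interpret M: left_module R M by fact
  interpret N: left_module R N by fact
  have "abelian_group (module_prod M N)"
  proof (rule abelian_groupI)
    fix x assume "x \<in> carrier (module_prod M N)"
    then show "\<exists>y\<in>carrier (module_prod M N). y \<oplus>\<^bsub>module_prod M N\<^esub> x = \<zero>\<^bsub>module_prod M N\<^esub>"
      by (intro bexI[of _ "(\<ominus>\<^bsub>M\<^esub> fst x, \<ominus>\<^bsub>N\<^esub> snd x)"]) (auto simp: M.M.l_neg N.M.l_neg)
  qed (auto simp: M.M.a_ac N.M.a_ac)
  then show ?thesis
    by (intro left_module.intro left_module_axioms.intro M.R.ring_axioms)
      (auto simp: M.smult_closed N.smult_closed M.smult_l_distr N.smult_l_distr M.smult_r_distr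
        N.smult_r_distr M.smult_assoc N.smult_assoc M.smult_one N.smult_one)
qed

lemma finsum_module_prod:
  assumes "abelian_group M" "abelian_group N" "abelian_group (module_prod M N)"
    and "finite A" "f \<in> A \<rightarrow> carrier M" "g \<in> A \<rightarrow> carrier N"
  shows "(\<Oplus>\<^bsub>module_prod M N\<^esub>i\<in>A. (f i, g i)) = (\<Oplus>\<^bsub>M\<^esub>i\<in>A. f i, \<Oplus>\<^bsub>N\<^esub>i\<in>A. g i)"
proof -
  interpret M: abelian_group M by fact
  interpret N: abelian_group N by fact
  interpret MN: abelian_group "module_prod M N" by fact
  show ?thesis using assms(4-6)
  proof (induction A rule: finite_induct)
    case (insert x A)
    then have "(\<lambda>i. (f i, g i)) \<in> A \<rightarrow> carrier (module_prod M N)" by auto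
    then show ?case using insert by (simp add: Pi_iff)
  qed simp
qed

section \<open>The grading and the weights of \<open>nabla\<close>\<close>

locale graded_module = graded_complex_algebra D nabla + M: left_module D M
  for D :: "(complex, 'd, 'e) module_scheme" (structure) and nabla
    and M :: "('d, 'm, 'f) module_scheme"
begin

lemma homogeneous_closed: "P \<in> H n \<Longrightarrow> P \<in> carrier D"
  by (simp add: H_iff)

lemma homogeneous_spans: "carrier D \<subseteq> add_span D (\<Union>n. H n)"
proof
  fix x assume "x \<in> carrier D"
  then obtain S f where S: "finite S" "S \<subseteq> \<int>"
      "f \<in> (\<Pi> c\<in>S. eigenspace D (smult D) (adjoint D nabla) c)" "x = (\<Oplus>c\<in>S. f c)"
    using adjoint_semisimple unfolding semisimple_operator_def by blast
  have "f c \<in> (\<Union>n. H n)" if "c \<in> S" for c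
  proof -
    obtain n where "c = of_int n" using S(2) \<open>c \<in> S\<close> by (auto elim!: Ints_cases)
    then show ?thesis using S(3) that unfolding homogeneous_def by auto
  qed
  then show "x \<in> add_span D (\<Union>n. H n)" unfolding S(4)
    by (intro add_span_finsum S) (auto intro: add_span.incl homogeneous_closed)
qed

lemma left_span_homogeneous:
  assumes S: "S \<subseteq> carrier M"
  shows "left_span D M S \<subseteq> add_span M {P \<odot>\<^bsub>M\<^esub> s | P s n. P \<in> H n \<and> s \<in> S}" (is "_ \<subseteq> add_span M ?G")
proof -
  have "a \<odot>\<^bsub>M\<^esub> s \<in> add_span M ?G" if s: "s \<in> S" and a: "a \<in> carrier D" for a s
  proof -
    have "a \<in> add_span D (\<Union>n. H n)" using homogeneous_spans a by blast
    then show ?thesis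
    proof induction
      case zero
      then show ?case using s S M.smult_l_null[of s] add_span.zero[of M] by auto
    next
      case (incl P)
      then show ?case using s by (intro add_span.incl) blast
    next
      case (add x y)
      have xy: "x \<in> carrier D" "y \<in> carrier D"
        using add.hyps add_span_closed[of "\<Union>n. H n"] homogeneous_closed by blast+
      have "s \<in> carrier M" using s S by blast
      then show ?case unfolding M.smult_l_distr[OF xy \<open>s \<in> carrier M\<close>]
        by (intro add_span.add add.IH)
    qed
  qed
  then have "add_span M {a \<odot>\<^bsub>M\<^esub> s | a s. a \<in> carrier D \<and> s \<in> S} \<subseteq> add_span M ?G"
    by (intro add_span_least) (auto intro: add_span.intros)
  then show ?thesis using M.left_span_subset_add_span[OF S] by blast
qed

abbreviation scal :: "complex \<Rightarrow> 'm \<Rightarrow> 'm" where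
  "scal c x \<equiv> (c \<odot> \<one>) \<odot>\<^bsub>M\<^esub> x"

definition weight_space :: "complex \<Rightarrow> 'm set" where
  "weight_space c = {x \<in> carrier M. nabla \<odot>\<^bsub>M\<^esub> x = scal c x}"

definition weight_sum :: "complex set \<Rightarrow> 'm set" where
  "weight_sum A = add_span M (\<Union>c\<in>A. weight_space c)"

lemma scalar_mult: "P \<in> carrier D \<Longrightarrow> (c \<odot> \<one>) \<otimes> P = c \<odot> P" "P \<in> carrier D \<Longrightarrow> P \<otimes> (c \<odot> \<one>) = c \<odot> P"
  by (simp_all add: smult_mult_left smult_mult_right)

lemma scalar_assoc: "P \<in> carrier D \<Longrightarrow> (c * d) \<odot> P = c \<odot> (d \<odot> P)"
  using C_mod.smult_assoc1[of c d P] by (simp add: complex_field_def)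

lemma scal_scal: "x \<in> carrier M \<Longrightarrow> scal c (scal d x) = scal (c * d) x"
  by (simp add: M.smult_assoc[symmetric] scalar_mult(1) scalar_assoc)

lemma scal_plus: "x \<in> carrier M \<Longrightarrow> scal (c + d) x = scal c x \<oplus>\<^bsub>M\<^esub> scal d x"
  by (simp add: scal_add M.smult_l_distr)

lemma scal_one: "x \<in> carrier M \<Longrightarrow> scal 1 x = x"
  using C_mod.smult_one[of \<one>] by (simp add: complex_field_def M.smult_one)

lemma scal_commute: "\<lbrakk>P \<in> carrier D; x \<in> carrier M\<rbrakk> \<Longrightarrow> P \<odot>\<^bsub>M\<^esub> scal c x = scal c (P \<odot>\<^bsub>M\<^esub> x)"
  by (simp add: M.smult_assoc[symmetric] scalar_mult)

lemma scal_eq_zero: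
  assumes "x \<in> carrier M" "c \<noteq> 0" "scal c x = \<zero>\<^bsub>M\<^esub>" shows "x = \<zero>\<^bsub>M\<^esub>"
  using scal_scal[of x "1 / c" c] assms by (simp add: scal_one M.smult_r_null)

lemma weight_space_closed: "weight_space c \<subseteq> carrier M"
  by (auto simp: weight_space_def)

lemma weight_sum_closed: "weight_sum A \<subseteq> carrier M"
  unfolding weight_sum_def by (rule M.add_span_closed) (auto simp: weight_space_def)

lemma weight_sum_mono: "A \<subseteq> B \<Longrightarrow> weight_sum A \<subseteq> weight_sum B"
  unfolding weight_sum_def by (rule add_span_mono) blast

lemma weight_sum_zero: "\<zero>\<^bsub>M\<^esub> \<in> weight_sum A"
  unfolding weight_sum_def by (rule add_span.zero)

lemma weight_sum_add: "\<lbrakk>x \<in> weight_sum A; y \<in> weight_sum A\<rbrakk> \<Longrightarrow> x \<oplus>\<^bsub>M\<^esub> y \<in> weight_sum A"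
  unfolding weight_sum_def by (rule add_span.add)

lemma weight_space_in_weight_sum: "c \<in> A \<Longrightarrow> weight_space c \<subseteq> weight_sum A"
  unfolding weight_sum_def by (auto intro: add_span.incl)

lemma weight_sum_minus: "x \<in> weight_sum A \<Longrightarrow> \<ominus>\<^bsub>M\<^esub> x \<in> weight_sum A"
  unfolding weight_sum_def
proof (rule M.add_span_minus)
  fix x assume "x \<in> (\<Union>c\<in>A. weight_space c)"
  then show "\<ominus>\<^bsub>M\<^esub> x \<in> (\<Union>c\<in>A. weight_space c)"
    unfolding weight_space_def
    by (auto simp: M.smult_r_minus nabla_closed)
qed (auto simp: weight_space_def)

lemma weight_space_shift:
  assumes "P \<in> H n" "x \<in> weight_space c" shows "P \<odot>\<^bsub>M\<^esub> x \<in> weight_space (c + of_int n)"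
proof -
  have P: "P \<in> carrier D" "nabla \<otimes> P = (of_int n \<odot> P) \<oplus> (P \<otimes> nabla)" using assms by (simp_all add: H_iff)
  have x: "x \<in> carrier M" "nabla \<odot>\<^bsub>M\<^esub> x = scal c x" using assms by (simp_all add: weight_space_def)
  have "nabla \<odot>\<^bsub>M\<^esub> (P \<odot>\<^bsub>M\<^esub> x) = ((of_int n \<odot> \<one>) \<otimes> P \<oplus> P \<otimes> nabla) \<odot>\<^bsub>M\<^esub> x"
    using P x nabla_closed by (simp add: M.smult_assoc[symmetric] scalar_mult)
  also have "\<dots> = scal (of_int n) (P \<odot>\<^bsub>M\<^esub> x) \<oplus>\<^bsub>M\<^esub> P \<odot>\<^bsub>M\<^esub> (scal c x)"
    using P(1) x nabla_closed by (simp add: M.smult_l_distr M.smult_assoc)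
  also have "\<dots> = scal (c + of_int n) (P \<odot>\<^bsub>M\<^esub> x)"
    using P(1) x by (simp add: scal_commute scal_plus M.smult_closed M.M.a_comm)
  finally show ?thesis using P(1) x by (simp add: weight_space_def M.smult_closed)
qed

lemma weight_sum_shift:
  assumes P: "P \<in> H n" and x: "x \<in> weight_sum A" and B: "(\<lambda>c. c + of_int n) ` A \<subseteq> B"
  shows "P \<odot>\<^bsub>M\<^esub> x \<in> weight_sum B"
  using x unfolding weight_sum_def
proof induction
  case zero
  then show ?case using P M.smult_r_null[of P] by (simp add: homogeneous_closed add_span.zero)
next
  case (incl x)
  then show ?case using weight_space_shift[OF P] B by (intro add_span.incl) blast
next
  case (add x y)
  have "x \<in> carrier M" "y \<in> carrier M" using add.hyps weight_sum_closed unfolding weight_sum_def by blast+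
  then show ?case using add.IH P by (simp add: M.smult_r_distr homogeneous_closed add_span.add)
qed

text \<open>
  Eigenvectors for distinct eigenvalues are independent: a sum of eigenvectors with eigenvalues in
  \<open>A\<close> is annihilated by a product of factors \<open>nabla - c\<close> with \<open>c \<in> A\<close>, whereas such a product
  multiplies an eigenvector with eigenvalue outside \<open>A\<close> by a nonzero scalar. The products are formed
  in \<open>D\<close>, where they commute with one another.
\<close>

definition nabla_minus :: "complex \<Rightarrow> 'd" where
  "nabla_minus c = nabla \<oplus> (- c) \<odot> \<one>"

definition nabla_poly :: "complex list \<Rightarrow> 'd" where
  "nabla_poly cs = foldr (\<lambda>c q. nabla_minus c \<otimes> q) cs \<one>"

lemma nabla_minus_closed [simp]: "nabla_minus c \<in> carrier D"
  by (simp add: nabla_minus_def nabla_closed)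

lemma nabla_poly_simps [simp]: "nabla_poly [] = \<one>" "nabla_poly (c # cs) = nabla_minus c \<otimes> nabla_poly cs"
  by (simp_all add: nabla_poly_def)

lemma nabla_poly_closed [simp]: "nabla_poly cs \<in> carrier D"
  by (induction cs) auto

lemma nabla_poly_append: "nabla_poly (cs @ ds) = nabla_poly cs \<otimes> nabla_poly ds"
  by (induction cs) (auto simp: m_assoc)

lemma nabla_minus_commute: "nabla_minus c \<otimes> nabla_minus d = nabla_minus d \<otimes> nabla_minus c"
  unfolding nabla_minus_def using nabla_closed scalar_assoc[of \<one> c d] scalar_assoc[of \<one> d c]
  by (simp add: l_distr r_distr scalar_mult scal_add2 scalar_assoc[symmetric] a_ac mult.commute)

lemma nabla_minus_poly_commute: "nabla_minus c \<otimes> nabla_poly ds = nabla_poly ds \<otimes> nabla_minus c"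
  by (induction ds) (simp_all, metis m_assoc nabla_minus_closed nabla_minus_commute nabla_poly_closed)

lemma nabla_poly_commute: "nabla_poly cs \<otimes> nabla_poly ds = nabla_poly ds \<otimes> nabla_poly cs"
  by (induction cs) (simp_all, metis m_assoc nabla_minus_closed nabla_minus_poly_commute nabla_poly_closed)

lemma nabla_minus_weight:
  assumes x: "x \<in> weight_space c" shows "nabla_minus d \<odot>\<^bsub>M\<^esub> x = scal (c - d) x"
proof -
  have x: "x \<in> carrier M" "nabla \<odot>\<^bsub>M\<^esub> x = scal c x" using assms by (simp_all add: weight_space_def)
  then have "nabla_minus d \<odot>\<^bsub>M\<^esub> x = scal (c + - d) x"
    unfolding scal_plus[OF x(1)] nabla_minus_def using nabla_closed by (simp add: M.smult_l_distr)
  then show ?thesis by simp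
qed

lemma nabla_poly_weight:
  assumes x: "x \<in> weight_space c" and c: "c \<notin> set ds"
  shows "\<exists>k. k \<noteq> 0 \<and> nabla_poly ds \<odot>\<^bsub>M\<^esub> x = scal k x"
  using c
proof (induction ds)
  case Nil
  then show ?case using x by (intro exI[of _ 1]) (simp add: weight_space_def scal_one M.smult_one)
next
  case (Cons d ds)
  have xc: "x \<in> carrier M" using x by (simp add: weight_space_def)
  obtain k where k: "k \<noteq> 0" "nabla_poly ds \<odot>\<^bsub>M\<^esub> x = scal k x" using Cons by auto
  have "nabla_poly (d # ds) \<odot>\<^bsub>M\<^esub> x = scal k (scal (c - d) x)"
    using k xc by (simp add: M.smult_assoc scal_commute[OF nabla_minus_closed] nabla_minus_weight[OF x])
  then have "nabla_poly (d # ds) \<odot>\<^bsub>M\<^esub> x = scal (k * (c - d)) x"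
    by (simp only: scal_scal[OF xc])
  moreover have "k * (c - d) \<noteq> 0" using k Cons.prems by simp
  ultimately show ?case by blast
qed

lemma weight_sum_annihilator:
  "x \<in> weight_sum A \<Longrightarrow> \<exists>cs. set cs \<subseteq> A \<and> nabla_poly cs \<odot>\<^bsub>M\<^esub> x = \<zero>\<^bsub>M\<^esub>"
  unfolding weight_sum_def
proof (induction rule: add_span.induct)
  case zero
  then show ?case using M.smult_r_null by (intro exI[of _ "[]"]) simp
next
  case (incl x)
  then obtain c where c: "c \<in> A" "x \<in> weight_space c" by blast
  then have "nabla_poly [c] \<odot>\<^bsub>M\<^esub> x = \<zero>\<^bsub>M\<^esub>"
    using nabla_minus_weight[of x c c] weight_space_closed[of c]
    by (auto simp: scal_0 M.smult_l_null)
  then show ?case using c by (intro exI[of _ "[c]"]) simp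
next
  case (add x y)
  then obtain cs ds where cs: "set cs \<subseteq> A" "nabla_poly cs \<odot>\<^bsub>M\<^esub> x = \<zero>\<^bsub>M\<^esub>"
    and ds: "set ds \<subseteq> A" "nabla_poly ds \<odot>\<^bsub>M\<^esub> y = \<zero>\<^bsub>M\<^esub>" by blast
  have xy: "x \<in> carrier M" "y \<in> carrier M" using add.hyps weight_sum_closed unfolding weight_sum_def by blast+
  have "nabla_poly (cs @ ds) \<odot>\<^bsub>M\<^esub> (x \<oplus>\<^bsub>M\<^esub> y) =
      (nabla_poly ds \<otimes> nabla_poly cs) \<odot>\<^bsub>M\<^esub> x \<oplus>\<^bsub>M\<^esub> (nabla_poly cs \<otimes> nabla_poly ds) \<odot>\<^bsub>M\<^esub> y"
    using xy by (simp add: nabla_poly_append M.smult_r_distr nabla_poly_commute[of ds cs])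
  also have "\<dots> = \<zero>\<^bsub>M\<^esub>" using xy cs ds by (simp add: M.smult_assoc M.smult_r_null)
  finally show ?case using cs ds by (intro exI[of _ "cs @ ds"]) simp
qed

lemma weights_independent:
  assumes "x \<in> weight_space c" "x \<in> weight_sum A" "c \<notin> A"
  shows "x = \<zero>\<^bsub>M\<^esub>"
proof -
  obtain cs where cs: "set cs \<subseteq> A" "nabla_poly cs \<odot>\<^bsub>M\<^esub> x = \<zero>\<^bsub>M\<^esub>"
    using weight_sum_annihilator[OF assms(2)] by blast
  then have "c \<notin> set cs" using assms(3) by blast
  then obtain k where "k \<noteq> 0" "scal k x = \<zero>\<^bsub>M\<^esub>" using nabla_poly_weight[OF assms(1)] cs by metis
  then show ?thesis using scal_eq_zero weight_space_closed assms(1) by blast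
qed

section \<open>Lowest weight vectors\<close>

abbreviation lowest :: "'m set" where
  "lowest \<equiv> ell_obj D nabla M (carrier M)"

lemma lowest_closed: "lowest \<subseteq> carrier M"
  by (auto simp: ell_obj_def)

lemma ell_obj_Int: "N \<subseteq> carrier M \<Longrightarrow> ell_obj D nabla M N = N \<inter> lowest"
  by (auto simp: ell_obj_def)

lemma homogeneous_in_D_neg: assumes "P \<in> H n" "n < 0" shows "P \<in> D_neg D nabla"
proof -
  have "P = (\<Oplus>i\<in>{n}. P)" using homogeneous_closed[OF assms(1)] by simp
  then show ?thesis unfolding D_neg_def using assms
    by (intro CollectI exI[of _ "{n}"] exI[of _ "\<lambda>_. P"]) auto
qed

lemma lowest_killed: "\<lbrakk>x \<in> lowest; P \<in> H n; n < 0\<rbrakk> \<Longrightarrow> P \<odot>\<^bsub>M\<^esub> x = \<zero>\<^bsub>M\<^esub>"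
  using homogeneous_in_D_neg unfolding ell_obj_def by blast

lemma D_negD: "P \<in> D_neg D nabla \<Longrightarrow> P \<in> carrier D"
  using D_neg_closed by blast

lemma lowest_zero: "\<zero>\<^bsub>M\<^esub> \<in> lowest"
  by (simp add: ell_obj_def M.smult_r_null D_negD)

lemma lowest_add: "\<lbrakk>x \<in> lowest; y \<in> lowest\<rbrakk> \<Longrightarrow> x \<oplus>\<^bsub>M\<^esub> y \<in> lowest"
  by (simp add: ell_obj_def M.smult_r_distr D_negD)

lemma lowest_minus: "x \<in> lowest \<Longrightarrow> \<ominus>\<^bsub>M\<^esub> x \<in> lowest"
  using M.M.minus_equality[of "\<zero>\<^bsub>M\<^esub>" "\<zero>\<^bsub>M\<^esub>"] by (simp add: ell_obj_def M.smult_r_minus D_negD)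

lemma lowest_D_zero:
  assumes P: "P \<in> H 0" and x: "x \<in> lowest" shows "P \<odot>\<^bsub>M\<^esub> x \<in> lowest"
proof -
  have c: "P \<in> carrier D" "x \<in> carrier M" using P x lowest_closed by (auto simp: homogeneous_closed)
  have "Q \<odot>\<^bsub>M\<^esub> (P \<odot>\<^bsub>M\<^esub> x) = \<zero>\<^bsub>M\<^esub>" if "Q \<in> D_neg D nabla" for Q
    using D_neg_D_zero[OF that] P x M.smult_assoc[OF D_negD[OF that] c]
    by (simp add: D_zero_def ell_obj_def)
  then show ?thesis using c by (simp add: ell_obj_def M.smult_closed)
qed

text \<open>The set \<open>D\<^sup>+U\<close>.\<close>

definition raised :: "'m set \<Rightarrow> 'm set" where
  "raised U = add_span M {P \<odot>\<^bsub>M\<^esub> x | P x n. 0 < n \<and> P \<in> H n \<and> x \<in> U}"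

lemma raised_zero: "\<zero>\<^bsub>M\<^esub> \<in> raised U" and
  raised_add: "\<lbrakk>x \<in> raised U; y \<in> raised U\<rbrakk> \<Longrightarrow> x \<oplus>\<^bsub>M\<^esub> y \<in> raised U"
  unfolding raised_def by (rule add_span.intros; assumption)+

lemma raised_incl: "\<lbrakk>0 < n; P \<in> H n; x \<in> U\<rbrakk> \<Longrightarrow> P \<odot>\<^bsub>M\<^esub> x \<in> raised U"
  unfolding raised_def by (rule add_span.incl) blast

lemma raised_least:
  assumes "\<zero>\<^bsub>M\<^esub> \<in> N" "\<And>x y. \<lbrakk>x \<in> N; y \<in> N\<rbrakk> \<Longrightarrow> x \<oplus>\<^bsub>M\<^esub> y \<in> N"
    "\<And>P x n. \<lbrakk>0 < n; P \<in> H n; x \<in> U\<rbrakk> \<Longrightarrow> P \<odot>\<^bsub>M\<^esub> x \<in> N"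
  shows "raised U \<subseteq> N"
  unfolding raised_def by (rule add_span_least) (use assms in auto)

lemma raised_closed: "raised (carrier M) \<subseteq> carrier M"
  by (rule raised_least) (auto intro: M.smult_closed homogeneous_closed)

text \<open>
  The left ideal \<open>D D\<^sup>-\<close> kills lowest weight vectors, so all representatives of a coset act in
  the same way.
\<close>

lemma coset_action:
  assumes m: "m \<in> lowest" and P: "P \<in> H 0"
  shows "smult (ell_module D nabla M) (II +>\<^bsub>D0\<^esub> P) m = P \<odot>\<^bsub>M\<^esub> m"
proof -
  interpret I: ideal II D0 by (rule zero_part_ideal)
  have c: "P \<in> carrier D" "m \<in> carrier M"
    using P m lowest_closed by (auto simp: homogeneous_closed)
  have "D_D_neg D nabla \<subseteq> {Q \<in> carrier D. Q \<odot>\<^bsub>M\<^esub> m = \<zero>\<^bsub>M\<^esub>}"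
    by (rule D_D_neg_least)
      (use c m in \<open>auto simp: M.smult_l_null M.smult_r_null M.smult_l_distr M.smult_assoc D_negD ell_obj_def\<close>)
  then have "Q \<odot>\<^bsub>M\<^esub> m = P \<odot>\<^bsub>M\<^esub> m" if "Q \<in> II +>\<^bsub>D0\<^esub> P" for Q
    using that c by (auto simp: a_r_coset_def' M.smult_l_distr M.smult_closed)
  moreover have "P \<in> II +>\<^bsub>D0\<^esub> P" using I.a_rcos_self[of P] P by (simp add: D_zero_def)
  ultimately have "the_elem ((\<lambda>Q. Q \<odot>\<^bsub>M\<^esub> m) ` (II +>\<^bsub>D0\<^esub> P)) = P \<odot>\<^bsub>M\<^esub> m"
    by (intro the_elem_image_unique) blast+
  then show ?thesis by (simp add: ell_module_def)
qed

lemma ball_R_ring: "(\<forall>X\<in>carrier (R_ring D nabla). Q X) \<longleftrightarrow> (\<forall>P\<in>H 0. Q (II +>\<^bsub>D0\<^esub> P))"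
  unfolding R_ring_def FactRing_simps by (auto simp: D_zero_def)

lemma ell_module_simps [simp]:
  "carrier (ell_module D nabla M) = lowest" "zero (ell_module D nabla M) = \<zero>\<^bsub>M\<^esub>"
  "add (ell_module D nabla M) = add M"
  by (simp_all add: ell_module_def)

abbreviation lowest_submodule :: "'m set \<Rightarrow> bool" where
  "lowest_submodule V \<equiv> submodule V (R_ring D nabla) (ell_module D nabla M)"

lemma lowest_submodule_iff:
  "lowest_submodule V \<longleftrightarrow> V \<subseteq> lowest \<and> \<zero>\<^bsub>M\<^esub> \<in> V \<and> (\<forall>x\<in>V. \<forall>y\<in>V. x \<oplus>\<^bsub>M\<^esub> y \<in> V) \<and>
     (\<forall>P\<in>H 0. \<forall>x\<in>V. P \<odot>\<^bsub>M\<^esub> x \<in> V)"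
proof -
  interpret E: left_module "R_ring D nabla" "ell_module D nabla M"
    by (rule ell_module_is_left_module[OF M.left_module_axioms])
  show ?thesis unfolding E.submodule_iff ball_R_ring
    by (auto simp: coset_action subset_iff)
qed

lemma lowest_submoduleD:
  assumes "lowest_submodule V"
  shows "x \<in> V \<Longrightarrow> x \<in> lowest" "x \<in> V \<Longrightarrow> x \<in> carrier M" "\<zero>\<^bsub>M\<^esub> \<in> V"
    "\<lbrakk>x \<in> V; y \<in> V\<rbrakk> \<Longrightarrow> x \<oplus>\<^bsub>M\<^esub> y \<in> V" "\<lbrakk>P \<in> H 0; x \<in> V\<rbrakk> \<Longrightarrow> P \<odot>\<^bsub>M\<^esub> x \<in> V"
  using assms lowest_closed unfolding lowest_submodule_iff by auto

lemma ell_homs_iff: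
  assumes "V \<subseteq> lowest" "W \<subseteq> lowest"
  shows "f \<in> module_homs (R_ring D nabla) (ell_module D nabla M) V W \<longleftrightarrow>
    f \<in> V \<rightarrow>\<^sub>E W \<and> (\<forall>x\<in>V. \<forall>y\<in>V. f (x \<oplus>\<^bsub>M\<^esub> y) = f x \<oplus>\<^bsub>M\<^esub> f y) \<and>
    (\<forall>P\<in>H 0. \<forall>x\<in>V. f (P \<odot>\<^bsub>M\<^esub> x) = P \<odot>\<^bsub>M\<^esub> f x)"
proof (cases "f \<in> V \<rightarrow>\<^sub>E W")
  case True
  then have "f x \<in> lowest" if "x \<in> V" for x using assms(2) that by blast
  then show ?thesis
    unfolding module_homs_def ball_R_ring using assms(1) by (simp add: coset_action subset_iff)
qed (simp add: module_homs_def)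

lemma ell_submodule:
  assumes N: "submodule N D M" shows "lowest_submodule (ell_obj D nabla M N)"
proof -
  have *: "ell_obj D nabla M N = N \<inter> lowest"
    by (rule ell_obj_Int) (use M.submoduleD(1)[OF N] in auto)
  show ?thesis unfolding lowest_submodule_iff *
    using M.submoduleD(2,3,4)[OF N] lowest_zero lowest_add lowest_D_zero
    by (simp add: homogeneous_closed)
qed

lemma delta_submodule:
  assumes "lowest_submodule V" shows "submodule (left_span D M V) D M" "V \<subseteq> left_span D M V"
proof -
  have "V \<subseteq> carrier M" using lowest_submoduleD(2)[OF assms] by auto
  then show "submodule (left_span D M V) D M" "V \<subseteq> left_span D M V"
    by (rule M.left_span_submodule M.left_span_superset)+
qed

end

locale semisimple_graded_module = graded_module D nabla M
  for D :: "(complex, 'd, 'e) module_scheme" (structure) and nabla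
    and M :: "('d, 'm, 'f) module_scheme" +
  assumes semisimple: "semisimple_module D M"
    and nabla_semisimple: "acts_semisimply D nabla M"
begin

lemma weight_decomposition:
  assumes "x \<in> carrier M"
  obtains S f where "finite S" "\<And>c. c \<in> S \<Longrightarrow> f c \<in> weight_space c" "x = (\<Oplus>\<^bsub>M\<^esub>c\<in>S. f c)"
proof -
  obtain S f where "finite S" "f \<in> (\<Pi> c\<in>S. eigenspace M scal (\<lambda>m. nabla \<odot>\<^bsub>M\<^esub> m) c)"
      "x = (\<Oplus>\<^bsub>M\<^esub>c\<in>S. f c)"
    using nabla_semisimple assms unfolding acts_semisimply_def semisimple_operator_def by metis
  then show ?thesis using that[of S f] by (auto simp: eigenspace_def weight_space_def Pi_iff)
qed

text \<open>
  The action of \<open>D\<close> on the lowest weight vector \<open>u\<close> does not decrease the real parts of weights below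
  the minimal one in \<open>u\<close>, and an operator of positive degree strictly increases them. So the component
  of \<open>u\<close> for a weight \<open>l\<close> with minimal real part is a sum of vectors of weights different from \<open>l\<close>.
\<close>

lemma lowest_self_raised:
  assumes u: "u \<in> lowest" and r: "u \<in> raised (left_span D M {u})"
  shows "u = \<zero>\<^bsub>M\<^esub>"
proof (rule ccontr)
  assume u0: "u \<noteq> \<zero>\<^bsub>M\<^esub>"
  have uc: "u \<in> carrier M" using u lowest_closed by blast
  obtain S f where S: "finite S" "\<And>c. c \<in> S \<Longrightarrow> f c \<in> weight_space c" "u = (\<Oplus>\<^bsub>M\<^esub>c\<in>S. f c)"
    using weight_decomposition[OF uc] by blast
  have fc: "f c \<in> carrier M" if "c \<in> S" for c using S(2)[OF that] weight_space_closed by blast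
  let ?S = "{c \<in> S. f c \<noteq> \<zero>\<^bsub>M\<^esub>}"
  have "?S \<noteq> {}"
  proof
    assume "?S = {}"
    then have "u = (\<Oplus>\<^bsub>M\<^esub>c\<in>S. \<zero>\<^bsub>M\<^esub>)" unfolding S(3) by (intro M.M.finsum_cong') auto
    then show False using u0 by simp
  qed
  \<comment> \<open>Weights are complex numbers; their real parts provide the order in which degree \<open>n\<close> moves by \<open>n\<close>.\<close>
  then obtain l where "is_arg_min Re (\<lambda>c. c \<in> ?S) l"
    using ex_is_arg_min_if_finite[of ?S Re] S(1) by auto
  then have l: "l \<in> S" "f l \<noteq> \<zero>\<^bsub>M\<^esub>" and min: "\<And>c. \<lbrakk>c \<in> S; f c \<noteq> \<zero>\<^bsub>M\<^esub>\<rbrakk> \<Longrightarrow> Re l \<le> Re c"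
    unfolding is_arg_min_def by (auto simp: not_less)
  have sums: "(\<Oplus>\<^bsub>M\<^esub>c\<in>B. f c) \<in> weight_sum A"
    if "B \<subseteq> S" "\<And>c. c \<in> B \<Longrightarrow> f c \<in> weight_sum A" for A B
    unfolding weight_sum_def
  proof (rule M.M.add_span_finsum)
    show "finite B" using that(1) S(1) finite_subset by blast
    show "(\<Union>c\<in>A. weight_space c) \<subseteq> carrier M" using weight_space_closed by blast
    show "f \<in> B \<rightarrow> add_span M (\<Union>c\<in>A. weight_space c)" using that(2) by (simp add: weight_sum_def)
  qed
  let ?A = "{c. Re l \<le> Re c}" and ?B = "{c. Re l < Re c}"
  have "u \<in> weight_sum ?A" unfolding S(3)
  proof (rule sums)
    show "f c \<in> weight_sum ?A" if "c \<in> S" for c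
    proof (cases "f c = \<zero>\<^bsub>M\<^esub>")
      case False
      then have "c \<in> ?A" using min[OF that] by simp
      then show ?thesis by (rule subsetD[OF weight_space_in_weight_sum S(2)[OF that]])
    qed (simp add: weight_sum_zero)
  qed simp
  then have Pu: "P \<odot>\<^bsub>M\<^esub> u \<in> weight_sum ?A" if "P \<in> H n" for P n
  proof (cases "n < 0")
    case True
    then show ?thesis using lowest_killed[OF u that] weight_sum_zero by simp
  next
    case False
    then have "(\<lambda>c. c + of_int n) ` ?A \<subseteq> ?A" by auto
    then show ?thesis by (rule weight_sum_shift[OF that \<open>u \<in> weight_sum ?A\<close>])
  qed
  have "add_span M {P \<odot>\<^bsub>M\<^esub> s | P s n. P \<in> H n \<and> s \<in> {u}} \<subseteq> weight_sum ?A"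
    by (rule add_span_least[OF weight_sum_zero weight_sum_add]) (use Pu in auto)
  then have U: "left_span D M {u} \<subseteq> weight_sum ?A"
    using left_span_homogeneous[of "{u}"] uc by blast
  have "raised (left_span D M {u}) \<subseteq> weight_sum ?B"
  proof (rule raised_least[OF weight_sum_zero weight_sum_add])
    fix P x n assume *: "0 < (n::int)" "P \<in> H n" "x \<in> left_span D M {u}"
    then have "(\<lambda>c. c + of_int n) ` ?A \<subseteq> ?B" by auto
    then show "P \<odot>\<^bsub>M\<^esub> x \<in> weight_sum ?B" by (rule weight_sum_shift[OF *(2) subsetD[OF U *(3)]])
  qed
  moreover have "weight_sum ?B \<subseteq> weight_sum (- {l})" by (rule weight_sum_mono) auto
  ultimately have u': "u \<in> weight_sum (- {l})" using r by blast
  have "(\<Oplus>\<^bsub>M\<^esub>c\<in>S - {l}. f c) \<in> weight_sum (- {l})" (is "?v \<in> _")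
  proof (rule sums)
    show "f c \<in> weight_sum (- {l})" if "c \<in> S - {l}" for c
      using that S(2)[of c] weight_space_in_weight_sum[of c "- {l}"] by auto
  qed simp_all
  then have v: "?v \<in> carrier M" "\<ominus>\<^bsub>M\<^esub> ?v \<in> weight_sum (- {l})"
    by (simp_all add: weight_sum_minus subsetD[OF weight_sum_closed])
  have "u = f l \<oplus>\<^bsub>M\<^esub> ?v"
    using M.M.finsum_insert[of "S - {l}" l f] S fc l(1) by (simp add: insert_absorb Pi_iff)
  then have "f l = u \<oplus>\<^bsub>M\<^esub> \<ominus>\<^bsub>M\<^esub> ?v" using v fc[OF l(1)] by (simp add: M.M.a_assoc M.M.r_neg)
  then have "f l \<in> weight_sum (- {l})" using weight_sum_add[OF u' v(2)] by simp
  then show False using weights_independent[OF S(2)[OF l(1)]] l(2) by blast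
qed

text \<open>
  The projection onto \<open>Du\<close> along a complement \<open>T\<close> maps \<open>D\<^sup>+M\<close> to \<open>D\<^sup>+(Du)\<close> and fixes \<open>u\<close>. In terms of
  submodules, \<open>D\<^sup>+M \<subseteq> D\<^sup>+(Du) + T\<close>, and the component of \<open>u\<close> in \<open>T\<close> is zero.
\<close>

lemma lowest_Int_raised:
  assumes u: "u \<in> lowest" and r: "u \<in> raised (carrier M)"
  shows "u = \<zero>\<^bsub>M\<^esub>"
proof (rule lowest_self_raised[OF u])
  let ?U = "left_span D M {u}"
  have uc: "u \<in> carrier M" using u lowest_closed by blast
  have U: "submodule ?U D M" by (rule M.left_span_submodule) (use uc in simp)
  have uU: "u \<in> ?U" using M.left_span_superset[of "{u}"] uc by blast
  obtain T where T: "submodule T D M" "?U \<inter> T = {\<zero>\<^bsub>M\<^esub>}" "?U <+>\<^bsub>M\<^esub> T = carrier M"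
    using M.semisimple_complement[OF semisimple U] by blast
  note Ud = M.submoduleD[OF U] and Td = M.submoduleD[OF T(1)]
  have rU: "raised ?U \<subseteq> ?U"
    by (rule raised_least[OF Ud(2,3)]) (use Ud(4) homogeneous_closed in blast)+
  have "raised (carrier M) \<subseteq> raised ?U <+>\<^bsub>M\<^esub> T"
  proof (rule raised_least)
    show "\<zero>\<^bsub>M\<^esub> \<in> raised ?U <+>\<^bsub>M\<^esub> T" using M.set_addI[OF raised_zero Td(2), of ?U] by simp
  next
    fix x y assume "x \<in> raised ?U <+>\<^bsub>M\<^esub> T" "y \<in> raised ?U <+>\<^bsub>M\<^esub> T"
    then obtain a b c d where *: "a \<in> raised ?U" "b \<in> T" "c \<in> raised ?U" "d \<in> T"
      "x = a \<oplus>\<^bsub>M\<^esub> b" "y = c \<oplus>\<^bsub>M\<^esub> d" by (auto simp: M.set_add_iff)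
    then have "x \<oplus>\<^bsub>M\<^esub> y = (a \<oplus>\<^bsub>M\<^esub> c) \<oplus>\<^bsub>M\<^esub> (b \<oplus>\<^bsub>M\<^esub> d)"
      using Td(1) Ud(1) rU by (simp add: M.M.a_ac subset_iff)
    then show "x \<oplus>\<^bsub>M\<^esub> y \<in> raised ?U <+>\<^bsub>M\<^esub> T"
      using M.set_addI[OF raised_add Td(3)] * by simp
  next
    fix P x n assume *: "0 < (n::int)" "P \<in> H n" "x \<in> carrier M"
    then obtain a b where ab: "a \<in> ?U" "b \<in> T" "x = a \<oplus>\<^bsub>M\<^esub> b"
      using T(3) M.set_add_iff by blast
    then have "P \<odot>\<^bsub>M\<^esub> x = P \<odot>\<^bsub>M\<^esub> a \<oplus>\<^bsub>M\<^esub> P \<odot>\<^bsub>M\<^esub> b"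
      using * Ud(1) Td(1) by (simp add: M.smult_r_distr homogeneous_closed)
    then show "P \<odot>\<^bsub>M\<^esub> x \<in> raised ?U <+>\<^bsub>M\<^esub> T"
      using M.set_addI[OF raised_incl[OF *(1,2) ab(1)] Td(4)[OF homogeneous_closed[OF *(2)] ab(2)]] by simp
  qed
  then obtain a b where ab: "a \<in> raised ?U" "b \<in> T" "u = a \<oplus>\<^bsub>M\<^esub> b"
    using r M.set_add_iff by blast
  then have "b = \<zero>\<^bsub>M\<^esub>" using M.disjoint_sum_cancel[OF U T(1,2), of a b] rU uU by blast
  moreover have "a \<in> carrier M" using ab(1) rU Ud(1) by blast
  ultimately have "u = a" using ab(3) by simp
  then show "u \<in> raised ?U" using ab(1) by simp
qed

text \<open>
  With a complement \<open>T\<close> of \<open>N\<close>, a lowest weight vector of \<open>M\<close> has lowest weight components in \<open>N\<close> and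
  \<open>T\<close>. Hence \<open>M = D \<ell>(M)\<close> is contained in \<open>D \<ell>(N) + T\<close>, and intersecting with \<open>N\<close> gives the claim.
\<close>

lemma delta_ell:
  assumes gen: "delta_obj D M lowest = carrier M" and N: "submodule N D M"
  shows "delta_obj D M (ell_obj D nabla M N) = N"
proof
  have Nc: "N \<subseteq> carrier M" by (rule subsetI) (rule M.submoduleD(1)[OF N])
  show "delta_obj D M (ell_obj D nabla M N) \<subseteq> N"
    unfolding delta_obj_def by (rule M.left_span_least[OF N]) (auto simp: ell_obj_def)
  obtain T where T: "submodule T D M" "N \<inter> T = {\<zero>\<^bsub>M\<^esub>}" "N <+>\<^bsub>M\<^esub> T = carrier M"
    using M.semisimple_complement[OF semisimple N] by blast
  note Nd = M.submoduleD[OF N] and Td = M.submoduleD[OF T(1)]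
  let ?N = "left_span D M (ell_obj D nabla M N)"
  have N': "submodule ?N D M"
    by (rule M.left_span_submodule) (use Nc in \<open>auto simp: ell_obj_def\<close>)
  have NN: "?N \<subseteq> N" by (rule M.left_span_least[OF N]) (auto simp: ell_obj_def)
  have "lowest \<subseteq> ?N <+>\<^bsub>M\<^esub> T"
  proof
    fix x assume x: "x \<in> lowest"
    then have "x \<in> carrier M" using lowest_closed by blast
    then obtain a b where ab: "a \<in> N" "b \<in> T" "x = a \<oplus>\<^bsub>M\<^esub> b" using T(3) M.set_add_iff by blast
    have "P \<odot>\<^bsub>M\<^esub> a = \<zero>\<^bsub>M\<^esub>" if P: "P \<in> D_neg D nabla" for P
    proof -
      have Pc: "P \<in> carrier D" using D_negD[OF P] .
      have "P \<odot>\<^bsub>M\<^esub> a \<oplus>\<^bsub>M\<^esub> P \<odot>\<^bsub>M\<^esub> b = \<zero>\<^bsub>M\<^esub>"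
        using x P M.smult_r_distr[OF Pc Nd(1)[OF ab(1)] Td(1)[OF ab(2)]] ab(3) by (simp add: ell_obj_def)
      then have "P \<odot>\<^bsub>M\<^esub> b = \<zero>\<^bsub>M\<^esub>" "P \<odot>\<^bsub>M\<^esub> a \<oplus>\<^bsub>M\<^esub> P \<odot>\<^bsub>M\<^esub> b = \<zero>\<^bsub>M\<^esub>"
        using M.disjoint_sum_cancel[OF N T(1,2) Nd(4)[OF Pc ab(1)] Td(4)[OF Pc ab(2)]] Nd(2) by simp_all
      then show ?thesis using Nd(1)[OF Nd(4)[OF Pc ab(1)]] by simp
    qed
    then have "a \<in> ell_obj D nabla M N" using ab by (simp add: ell_obj_def)
    then have "a \<in> ?N" using M.left_span_superset[of "ell_obj D nabla M N"] Nc by (auto simp: ell_obj_def)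
    then show "x \<in> ?N <+>\<^bsub>M\<^esub> T" using M.set_addI ab by blast
  qed
  then have all: "carrier M \<subseteq> ?N <+>\<^bsub>M\<^esub> T"
    using M.left_span_least[OF M.submodule_set_add[OF N' T(1)]] gen unfolding delta_obj_def by blast
  show "N \<subseteq> delta_obj D M (ell_obj D nabla M N)"
  proof
    fix x assume x: "x \<in> N"
    then obtain a b where ab: "a \<in> ?N" "b \<in> T" "x = a \<oplus>\<^bsub>M\<^esub> b" using all Nc M.set_add_iff by blast
    then have "b = \<zero>\<^bsub>M\<^esub>" using M.disjoint_sum_cancel[OF N T(1,2), of a b] NN x by blast
    then show "x \<in> delta_obj D M (ell_obj D nabla M N)"
      using ab NN Nd(1) unfolding delta_obj_def by (simp add: subset_iff)
  qed
qed


section \<open>Extending homomorphisms of lowest weight vectors\<close>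

text \<open>
  The relation between \<open>\<Sum>i. P i v i\<close> and \<open>\<Sum>i. P i (f (v i))\<close>. Generating it as a submodule of
  \<open>M \<times> M\<close> makes its compatibility with addition and with the action of \<open>D\<close> automatic.
\<close>

definition extension_graph :: "'m set \<Rightarrow> ('m \<Rightarrow> 'm) \<Rightarrow> ('m \<times> 'm) set" where
  "extension_graph V f = left_span D (module_prod M M) ((\<lambda>v. (v, f v)) ` V)"

sublocale MM: left_module D "module_prod M M"
  by (rule left_module_prod[OF M.left_module_axioms M.left_module_axioms])

sublocale MM: graded_module D nabla "module_prod M M" ..

lemma extension_graph_iff:
  assumes "V \<subseteq> carrier M" "f \<in> V \<rightarrow> carrier M"
  shows "(x, y) \<in> extension_graph V f \<longleftrightarrow> (\<exists>(n::nat) P v.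
     P \<in> {..<n} \<rightarrow> carrier D \<and> v \<in> {..<n} \<rightarrow> V \<and>
     x = (\<Oplus>\<^bsub>M\<^esub>i\<in>{..<n}. P i \<odot>\<^bsub>M\<^esub> v i) \<and> y = (\<Oplus>\<^bsub>M\<^esub>i\<in>{..<n}. P i \<odot>\<^bsub>M\<^esub> f (v i)))"
    (is "_ \<longleftrightarrow> (\<exists>n P v. ?rep n P v)")
proof -
  have sum: "(\<Oplus>\<^bsub>module_prod M M\<^esub>i\<in>{..<n}. P i \<odot>\<^bsub>module_prod M M\<^esub> (v i, f (v i))) =
      (\<Oplus>\<^bsub>M\<^esub>i\<in>{..<n}. P i \<odot>\<^bsub>M\<^esub> v i, \<Oplus>\<^bsub>M\<^esub>i\<in>{..<n}. P i \<odot>\<^bsub>M\<^esub> f (v i))"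
    if "P \<in> {..<n} \<rightarrow> carrier D" "v \<in> {..<n} \<rightarrow> V" for n :: nat and P v
    unfolding module_prod_simps
    by (rule finsum_module_prod[OF M.M.abelian_group_axioms M.M.abelian_group_axioms
          MM.M.abelian_group_axioms])
      (use that assms in \<open>auto intro!: M.smult_closed simp: Pi_iff subset_iff\<close>)
  show ?thesis
  proof
    assume "(x, y) \<in> extension_graph V f"
    then obtain n :: nat and P s where *: "P \<in> {..<n} \<rightarrow> carrier D" "s \<in> {..<n} \<rightarrow> (\<lambda>v. (v, f v)) ` V"
      "(x, y) = (\<Oplus>\<^bsub>module_prod M M\<^esub>i\<in>{..<n}. P i \<odot>\<^bsub>module_prod M M\<^esub> s i)"
      unfolding extension_graph_def left_span_def by auto
    let ?v = "\<lambda>i. fst (s i)"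
    have s: "s i = (?v i, f (?v i)) \<and> ?v i \<in> V" if "i < n" for i
    proof -
      have "s i \<in> (\<lambda>v. (v, f v)) ` V" using funcset_mem[OF *(2), of i] that by simp
      then show ?thesis by auto
    qed
    have "(\<Oplus>\<^bsub>module_prod M M\<^esub>i\<in>{..<n}. P i \<odot>\<^bsub>module_prod M M\<^esub> s i) =
        (\<Oplus>\<^bsub>module_prod M M\<^esub>i\<in>{..<n}. P i \<odot>\<^bsub>module_prod M M\<^esub> (?v i, f (?v i)))"
      by (rule MM.M.finsum_cong')
        (use s *(1) assms in \<open>auto simp: Pi_iff subset_iff intro!: M.smult_closed\<close>)
    then have "?rep n P ?v" using *(1,3) s sum[of P n ?v] by auto
    then show "\<exists>n P v. ?rep n P v" by blast
  next
    assume "\<exists>n P v. ?rep n P v"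
    then obtain n :: nat and P v where *: "?rep n P v" by blast
    then have "(x, y) = (\<Oplus>\<^bsub>module_prod M M\<^esub>i\<in>{..<n}. P i \<odot>\<^bsub>module_prod M M\<^esub> (v i, f (v i)))"
      using sum[of P n v] by simp
    moreover have "(\<lambda>i. (v i, f (v i))) \<in> {..<n} \<rightarrow> (\<lambda>v. (v, f v)) ` V" using * by auto
    ultimately show "(x, y) \<in> extension_graph V f"
      unfolding extension_graph_def left_span_def using *
      by (intro CollectI exI[of _ n] exI[of _ P] exI[of _ "\<lambda>i. (v i, f (v i))"]) simp
  qed
qed

text \<open>Here \<open>p\<close> is a difference of lowest weight vectors, so it is a lowest weight vector in \<open>D\<^sup>+M\<close>.\<close>

lemma raised_part_of_lowest:
  assumes V: "lowest_submodule V" and v: "v \<in> V" and p: "p \<in> raised (carrier M)" and x: "v \<oplus>\<^bsub>M\<^esub> p \<in> lowest"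
  shows "p = \<zero>\<^bsub>M\<^esub>"
proof (rule lowest_Int_raised[OF _ p])
  have "p \<in> carrier M" "v \<in> carrier M" using raised_closed p lowest_submoduleD(2)[OF V v] by blast+
  then have "p = \<ominus>\<^bsub>M\<^esub> v \<oplus>\<^bsub>M\<^esub> (v \<oplus>\<^bsub>M\<^esub> p)" by (simp add: M.M.r_neg1)
  then show "p \<in> lowest" using lowest_add[OF lowest_minus[OF lowest_submoduleD(1)[OF V v]] x] by simp
qed

context
  fixes V W f
  assumes V: "lowest_submodule V" and W: "lowest_submodule W"
    and f: "f \<in> module_homs (R_ring D nabla) (ell_module D nabla M) V W"
begin

lemma lowest_hom:
  "f \<in> V \<rightarrow>\<^sub>E W" "x \<in> V \<Longrightarrow> f x \<in> W"
  "\<lbrakk>x \<in> V; y \<in> V\<rbrakk> \<Longrightarrow> f (x \<oplus>\<^bsub>M\<^esub> y) = f x \<oplus>\<^bsub>M\<^esub> f y"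
  "\<lbrakk>P \<in> H 0; x \<in> V\<rbrakk> \<Longrightarrow> f (P \<odot>\<^bsub>M\<^esub> x) = P \<odot>\<^bsub>M\<^esub> f x" "f \<zero>\<^bsub>M\<^esub> = \<zero>\<^bsub>M\<^esub>"
proof -
  have "V \<subseteq> lowest" "W \<subseteq> lowest" using lowest_submoduleD(1)[OF V] lowest_submoduleD(1)[OF W] by auto
  note * = f[unfolded ell_homs_iff[OF this]]
  show "f \<in> V \<rightarrow>\<^sub>E W" "x \<in> V \<Longrightarrow> f x \<in> W" "\<lbrakk>x \<in> V; y \<in> V\<rbrakk> \<Longrightarrow> f (x \<oplus>\<^bsub>M\<^esub> y) = f x \<oplus>\<^bsub>M\<^esub> f y"
    and lin: "\<And>P x. \<lbrakk>P \<in> H 0; x \<in> V\<rbrakk> \<Longrightarrow> f (P \<odot>\<^bsub>M\<^esub> x) = P \<odot>\<^bsub>M\<^esub> f x"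
    using * by auto
  have "f \<zero>\<^bsub>M\<^esub> \<in> carrier M" using * lowest_submoduleD(3)[OF V] lowest_submoduleD(2)[OF W] by blast
  then show "f \<zero>\<^bsub>M\<^esub> = \<zero>\<^bsub>M\<^esub>"
    using lin[OF H_zero lowest_submoduleD(3)[OF V]] by (simp add: M.smult_l_null)
qed

lemma graph_closed: "(\<lambda>v. (v, f v)) ` V \<subseteq> carrier (module_prod M M)"
  using lowest_hom(2) lowest_submoduleD(2)[OF V] lowest_submoduleD(2)[OF W] by auto

lemma extension_graph_submodule: "submodule (extension_graph V f) D (module_prod M M)"
  unfolding extension_graph_def by (rule MM.left_span_submodule[OF graph_closed])

lemma extension_graphI: "v \<in> V \<Longrightarrow> (v, f v) \<in> extension_graph V f"
  unfolding extension_graph_def using MM.left_span_superset[OF graph_closed] by auto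

lemma extension_graph_range:
  assumes "(x, y) \<in> extension_graph V f"
  shows "x \<in> left_span D M V" "y \<in> left_span D M W"
proof -
  have "submodule (left_span D M V \<times> left_span D M W) D (module_prod M M)"
    using delta_submodule(1)[OF V] delta_submodule(1)[OF W]
    unfolding MM.submodule_iff M.submodule_iff by auto
  then have "extension_graph V f \<subseteq> left_span D M V \<times> left_span D M W"
    unfolding extension_graph_def
    by (rule MM.left_span_least)
      (use lowest_hom(2) delta_submodule(2)[OF V] delta_submodule(2)[OF W] in auto)
  then show "x \<in> left_span D M V" "y \<in> left_span D M W" using assms by auto
qed

text \<open>The first components form a submodule that contains \<open>V\<close>.\<close>

lemma extension_graph_total:
  assumes "x \<in> left_span D M V" shows "\<exists>y. (x, y) \<in> extension_graph V f"
proof -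
  note G = MM.submoduleD[OF extension_graph_submodule]
  let ?X = "{x. \<exists>y. (x, y) \<in> extension_graph V f}"
  have "submodule ?X D M"
    unfolding M.submodule_iff
  proof (intro conjI ballI subsetI)
    show "x \<in> carrier M" if "x \<in> ?X" for x using that G(1) by force
    show "\<zero>\<^bsub>M\<^esub> \<in> ?X" using G(2) by auto
    show "x \<oplus>\<^bsub>M\<^esub> y \<in> ?X" if "x \<in> ?X" "y \<in> ?X" for x y
      using that G(3)[of "(x, _)" "(y, _)"] by auto
    show "a \<odot>\<^bsub>M\<^esub> x \<in> ?X" if "a \<in> carrier D" "x \<in> ?X" for a x
      using that G(4)[of a "(x, _)"] by auto
  qed
  then have "left_span D M V \<subseteq> ?X"
    by (rule M.left_span_least) (use extension_graphI in blast)
  then show ?thesis using assms by blast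
qed

text \<open>
  A homogeneous element of \<open>D\<close> applied to \<open>(v, f v)\<close> gives zero in negative degree, another pair in
  the graph of \<open>f\<close> in degree zero, as \<open>f\<close> is linear over \<open>D\<^sup>0\<close>, and a pair of vectors in \<open>D\<^sup>+M\<close> in
  positive degree.
\<close>

lemma extension_graph_decomposition:
  assumes xy: "(x, y) \<in> extension_graph V f"
  obtains v p q where "v \<in> V" "p \<in> raised (carrier M)" "q \<in> raised (carrier M)"
    "x = v \<oplus>\<^bsub>M\<^esub> p" "y = f v \<oplus>\<^bsub>M\<^esub> q"
proof -
  note Vd = lowest_submoduleD[OF V] and Wd = lowest_submoduleD[OF W]
  have rc: "p \<in> carrier M" if "p \<in> raised (carrier M)" for p using that raised_closed by blast
  let ?N = "{(v \<oplus>\<^bsub>M\<^esub> p, f v \<oplus>\<^bsub>M\<^esub> q) | v p q.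
    v \<in> V \<and> p \<in> raised (carrier M) \<and> q \<in> raised (carrier M)}"
  have I: "(v \<oplus>\<^bsub>M\<^esub> p, f v \<oplus>\<^bsub>M\<^esub> q) \<in> ?N"
    if "v \<in> V" "p \<in> raised (carrier M)" "q \<in> raised (carrier M)" for v p q using that by blast
  have "add_span (module_prod M M)
      {P \<odot>\<^bsub>module_prod M M\<^esub> s | P s n. P \<in> H n \<and> s \<in> (\<lambda>v. (v, f v)) ` V} \<subseteq> ?N"
  proof (rule add_span_least)
    show "\<zero>\<^bsub>module_prod M M\<^esub> \<in> ?N"
      using I[OF Vd(3) raised_zero raised_zero] by (simp add: lowest_hom(5))
  next
    fix x y assume "x \<in> ?N" "y \<in> ?N"
    then obtain v p q v' p' q' where *: "v \<in> V" "p \<in> raised (carrier M)" "q \<in> raised (carrier M)"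
      "v' \<in> V" "p' \<in> raised (carrier M)" "q' \<in> raised (carrier M)"
      "x = (v \<oplus>\<^bsub>M\<^esub> p, f v \<oplus>\<^bsub>M\<^esub> q)" "y = (v' \<oplus>\<^bsub>M\<^esub> p', f v' \<oplus>\<^bsub>M\<^esub> q')" by blast
    then have "x \<oplus>\<^bsub>module_prod M M\<^esub> y =
        ((v \<oplus>\<^bsub>M\<^esub> v') \<oplus>\<^bsub>M\<^esub> (p \<oplus>\<^bsub>M\<^esub> p'), f (v \<oplus>\<^bsub>M\<^esub> v') \<oplus>\<^bsub>M\<^esub> (q \<oplus>\<^bsub>M\<^esub> q'))"
      by (simp add: M.M.a_ac rc Vd(2) Wd(2) lowest_hom(2,3))
    then show "x \<oplus>\<^bsub>module_prod M M\<^esub> y \<in> ?N" using I[OF Vd(4) raised_add raised_add] * by simp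
  next
    have "(P \<odot>\<^bsub>M\<^esub> v, P \<odot>\<^bsub>M\<^esub> f v) \<in> ?N" if P: "P \<in> H n" and v: "v \<in> V" for P n v
    proof -
      have c: "P \<in> carrier D" "v \<in> carrier M" "f v \<in> carrier M"
        using homogeneous_closed[OF P] Vd(2)[OF v] Wd(2)[OF lowest_hom(2)[OF v]] .
      consider "n < 0" | "n = 0" | "n > 0" by linarith
      then show ?thesis
      proof cases
        case 1
        then show ?thesis
          using lowest_killed[OF Vd(1)[OF v] P] lowest_killed[OF Wd(1)[OF lowest_hom(2)[OF v]] P]
            I[OF Vd(3) raised_zero raised_zero] by (simp add: lowest_hom(5))
      next
        case 2
        then show ?thesis using I[OF Vd(5)[OF _ v] raised_zero raised_zero, of P] P c v
          by (simp add: M.smult_closed lowest_hom(4))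
      next
        case 3
        then show ?thesis using I[OF Vd(3) raised_incl[OF 3 P c(2)] raised_incl[OF 3 P c(3)]] c
          by (simp add: M.smult_closed lowest_hom(5))
      qed
    qed
    then show "{P \<odot>\<^bsub>module_prod M M\<^esub> s | P s n. P \<in> H n \<and> s \<in> (\<lambda>v. (v, f v)) ` V} \<subseteq> ?N"
      by (intro subsetI) (elim CollectE exE conjE imageE, simp only: module_prod_simps)
  qed
  then have "(x, y) \<in> ?N"
    using MM.left_span_homogeneous[OF graph_closed] xy unfolding extension_graph_def by blast
  then show ?thesis using that by blast
qed

text \<open>
  Single-valuedness. The submodule \<open>K\<close> of all \<open>y\<close> related to zero contains no nonzero lowest weight
  vector, and a submodule of \<open>M\<close> is generated by its lowest weight vectors.
\<close>

lemma extension_graph_zero: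
  assumes gen: "delta_obj D M lowest = carrier M" and y: "(\<zero>\<^bsub>M\<^esub>, y) \<in> extension_graph V f"
  shows "y = \<zero>\<^bsub>M\<^esub>"
proof -
  note G = MM.submoduleD[OF extension_graph_submodule]
  note Vd = lowest_submoduleD[OF V]
  let ?K = "{y. (\<zero>\<^bsub>M\<^esub>, y) \<in> extension_graph V f}"
  have K: "submodule ?K D M"
    unfolding M.submodule_iff
  proof (intro conjI ballI subsetI)
    show "y \<in> carrier M" if "y \<in> ?K" for y using that G(1) by force
    show "\<zero>\<^bsub>M\<^esub> \<in> ?K" using G(2) by simp
    show "y \<oplus>\<^bsub>M\<^esub> z \<in> ?K" if "y \<in> ?K" "z \<in> ?K" for y z
      using that G(3)[of "(\<zero>\<^bsub>M\<^esub>, y)" "(\<zero>\<^bsub>M\<^esub>, z)"] by simp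
    show "a \<odot>\<^bsub>M\<^esub> y \<in> ?K" if "a \<in> carrier D" "y \<in> ?K" for a y
      using that G(4)[of a "(\<zero>\<^bsub>M\<^esub>, y)"] by (simp add: M.smult_r_null)
  qed
  have "ell_obj D nabla M ?K \<subseteq> {\<zero>\<^bsub>M\<^esub>}"
  proof
    fix z assume "z \<in> ell_obj D nabla M ?K"
    then have z: "(\<zero>\<^bsub>M\<^esub>, z) \<in> extension_graph V f" "z \<in> lowest"
      using M.submoduleD(1)[OF K] by (auto simp: ell_obj_def)
    obtain v p q where *: "v \<in> V" "p \<in> raised (carrier M)" "q \<in> raised (carrier M)"
      "\<zero>\<^bsub>M\<^esub> = v \<oplus>\<^bsub>M\<^esub> p" "z = f v \<oplus>\<^bsub>M\<^esub> q" using extension_graph_decomposition[OF z(1)] .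
    have "p = \<zero>\<^bsub>M\<^esub>" using raised_part_of_lowest[OF V *(1,2)] *(4) lowest_zero by simp
    then have "v = \<zero>\<^bsub>M\<^esub>" using *(4) M.M.r_zero[OF Vd(2)[OF *(1)]] by simp
    then have "z = q" using *(3,5) raised_closed by (simp add: lowest_hom(5) subset_iff)
    then show "z \<in> {\<zero>\<^bsub>M\<^esub>}" using lowest_Int_raised z(2) *(3) by simp
  qed
  then have "left_span D M (ell_obj D nabla M ?K) \<subseteq> {\<zero>\<^bsub>M\<^esub>}"
    by (rule M.left_span_least[OF M.submodule_zero])
  then have "?K \<subseteq> {\<zero>\<^bsub>M\<^esub>}" by (simp only: delta_ell[OF gen K, unfolded delta_obj_def])
  then show ?thesis using y by blast
qed

lemma extension_graph_unique:
  assumes gen: "delta_obj D M lowest = carrier M"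
    and y: "(x, y) \<in> extension_graph V f" and z: "(x, z) \<in> extension_graph V f"
  shows "y = z"
proof -
  note G = MM.submoduleD[OF extension_graph_submodule]
  have c: "x \<in> carrier M" "y \<in> carrier M" "z \<in> carrier M" using G(1)[OF y] G(1)[OF z] by auto
  have "(x, y) \<oplus>\<^bsub>module_prod M M\<^esub> (\<ominus> \<one>) \<odot>\<^bsub>module_prod M M\<^esub> (x, z) \<in> extension_graph V f"
    using G(3)[OF y G(4)[OF _ z]] by simp
  then have "y \<oplus>\<^bsub>M\<^esub> \<ominus>\<^bsub>M\<^esub> z = \<zero>\<^bsub>M\<^esub>"
    using c by (intro extension_graph_zero[OF gen]) (simp add: M.smult_l_minus M.M.r_neg)
  then show ?thesis using c M.M.minus_equality[of y "\<ominus>\<^bsub>M\<^esub> z"] by simp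
qed

lemma delta_mor_eq_iff:
  assumes gen: "delta_obj D M lowest = carrier M" and x: "x \<in> left_span D M V"
  shows "delta_mor D M V W f x = y \<longleftrightarrow> (x, y) \<in> extension_graph V f"
proof -
  have "V \<subseteq> carrier M" "f \<in> V \<rightarrow> carrier M"
    using lowest_hom(2) lowest_submoduleD(2)[OF V] lowest_submoduleD(2)[OF W] by auto
  then have "delta_mor D M V W f x = (THE y. (x, y) \<in> extension_graph V f)"
    using x by (simp add: delta_mor_def delta_obj_def extension_graph_iff)
  moreover have "\<exists>!y. (x, y) \<in> extension_graph V f"
    using extension_graph_total[OF x] extension_graph_unique[OF gen] by blast
  ultimately show ?thesis by (metis theI')
qed

lemma delta_mor_extends:
  assumes gen: "delta_obj D M lowest = carrier M" and v: "v \<in> V"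
  shows "delta_mor D M V W f v = f v"
  using delta_mor_eq_iff[OF gen, of v] delta_submodule(2)[OF V] extension_graphI v by blast

lemma delta_mor_hom:
  assumes gen: "delta_obj D M lowest = carrier M"
  shows "delta_mor D M V W f \<in> module_homs D M (delta_obj D M V) (delta_obj D M W)"
proof -
  note G = MM.submoduleD[OF extension_graph_submodule]
  note U = M.submoduleD[OF delta_submodule(1)[OF V]]
  have val: "(x, delta_mor D M V W f x) \<in> extension_graph V f" if "x \<in> left_span D M V" for x
    using delta_mor_eq_iff[OF gen that] by blast
  have "delta_mor D M V W f \<in> left_span D M V \<rightarrow>\<^sub>E left_span D M W"
    using extension_graph_range(2)[OF val] by (auto simp: delta_mor_def delta_obj_def)
  moreover have "delta_mor D M V W f (x \<oplus>\<^bsub>M\<^esub> y) = delta_mor D M V W f x \<oplus>\<^bsub>M\<^esub> delta_mor D M V W f y"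
    if "x \<in> left_span D M V" "y \<in> left_span D M V" for x y
    using G(3)[OF val[OF that(1)] val[OF that(2)]] by (simp add: delta_mor_eq_iff[OF gen U(3)[OF that]])
  moreover have "delta_mor D M V W f (a \<odot>\<^bsub>M\<^esub> x) = a \<odot>\<^bsub>M\<^esub> delta_mor D M V W f x"
    if "a \<in> carrier D" "x \<in> left_span D M V" for a x
    using G(4)[OF that(1) val[OF that(2)]] by (simp add: delta_mor_eq_iff[OF gen U(4)[OF that]])
  ultimately show ?thesis unfolding module_homs_def delta_obj_def by blast
qed

text \<open>
  The graph of \<open>g\<close> is a submodule that contains the graph of \<open>f\<close>, hence contains
  \<^term>\<open>extension_graph V f\<close>, which is the graph of the extension.
\<close>

lemma delta_mor_unique:
  assumes gen: "delta_obj D M lowest = carrier M"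
    and g: "g \<in> module_homs D M (delta_obj D M V) N" and N: "submodule N D M"
    and gf: "\<And>v. v \<in> V \<Longrightarrow> g v = f v"
  shows "delta_mor D M V W f = g"
proof
  note U = M.submoduleD[OF delta_submodule(1)[OF V]]
  have gh: "g \<in> left_span D M V \<rightarrow>\<^sub>E N"
    "\<And>x y. \<lbrakk>x \<in> left_span D M V; y \<in> left_span D M V\<rbrakk> \<Longrightarrow> g (x \<oplus>\<^bsub>M\<^esub> y) = g x \<oplus>\<^bsub>M\<^esub> g y"
    "\<And>a x. \<lbrakk>a \<in> carrier D; x \<in> left_span D M V\<rbrakk> \<Longrightarrow> g (a \<odot>\<^bsub>M\<^esub> x) = a \<odot>\<^bsub>M\<^esub> g x"
    using g unfolding module_homs_def delta_obj_def by auto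
  have gc: "g x \<in> carrier M" if "x \<in> left_span D M V" for x
    using gh(1) that M.submoduleD(1)[OF N] by blast
  have g0: "g \<zero>\<^bsub>M\<^esub> = \<zero>\<^bsub>M\<^esub>" using gh(3)[OF _ U(2), of \<zero>] gc[OF U(2)] by (simp add: M.smult_l_null)
  let ?\<Gamma> = "(\<lambda>x. (x, g x)) ` left_span D M V"
  have "submodule ?\<Gamma> D (module_prod M M)"
    unfolding MM.submodule_iff using gh(2,3) gc g0 U by (auto simp: image_iff)
  then have "extension_graph V f \<subseteq> ?\<Gamma>"
    unfolding extension_graph_def
    by (rule MM.left_span_least) (use gf delta_submodule(2)[OF V] in \<open>auto simp: image_iff\<close>)
  then have "delta_mor D M V W f x = g x" if "x \<in> left_span D M V" for x
    using delta_mor_eq_iff[OF gen that, of "delta_mor D M V W f x"] by auto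
  moreover have "delta_mor D M V W f x = g x" if "x \<notin> left_span D M V" for x
    using that by (simp only: delta_mor_def delta_obj_def restrict_apply if_False PiE_arb[OF gh(1) that])
  ultimately show "delta_mor D M V W f x = g x" for x by blast
qed

end

lemma identity_hom:
  assumes V: "lowest_submodule V"
  shows "restrict (\<lambda>x. x) V \<in> module_homs (R_ring D nabla) (ell_module D nabla M) V V"
proof -
  have "V \<subseteq> lowest" using lowest_submoduleD(1)[OF V] by auto
  then show ?thesis using lowest_submoduleD(4,5)[OF V] by (simp add: ell_homs_iff)
qed

text \<open>
  Applying the decomposition to the identity of \<open>V\<close> shows \<open>DV \<subseteq> V + D\<^sup>+M\<close>; the second summand of a
  lowest weight vector then vanishes.
\<close>

lemma ell_delta:
  assumes V: "lowest_submodule V"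
  shows "ell_obj D nabla M (delta_obj D M V) = V"
proof
  note Vd = lowest_submoduleD[OF V]
  show "V \<subseteq> ell_obj D nabla M (delta_obj D M V)"
    using delta_submodule(2)[OF V] Vd(1) by (auto simp: ell_obj_def delta_obj_def)
  show "ell_obj D nabla M (delta_obj D M V) \<subseteq> V"
  proof
    fix x assume "x \<in> ell_obj D nabla M (delta_obj D M V)"
    then have x: "x \<in> left_span D M V" "x \<in> lowest"
      using M.submoduleD(1)[OF delta_submodule(1)[OF V]] by (auto simp: ell_obj_def delta_obj_def)
    obtain v p where vp: "v \<in> V" "p \<in> raised (carrier M)" "x = v \<oplus>\<^bsub>M\<^esub> p"
      using extension_graph_total[OF V V identity_hom[OF V] x(1)]
        extension_graph_decomposition[OF V V identity_hom[OF V]] by metis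
    then have "p = \<zero>\<^bsub>M\<^esub>" using raised_part_of_lowest[OF V] x(2) by blast
    then show "x \<in> V" using vp Vd(2) by simp
  qed
qed

section \<open>The isomorphism of categories\<close>

lemma Mod_cat_simps:
  "Obj (Mod_cat R N) = {A. submodule A R N}" "Hom (Mod_cat R N) = module_homs R N"
  "Ident (Mod_cat R N) A = restrict (\<lambda>x. x) A" "Comp (Mod_cat R N) A B C g f = compose A g f"
  by (simp_all add: Mod_cat_def)

lemma ell_mor_hom:
  assumes A: "submodule A D M" and B: "submodule B D M" and f: "f \<in> module_homs D M A B"
  shows "ell_mor D nabla M A B f \<in>
    module_homs (R_ring D nabla) (ell_module D nabla M) (ell_obj D nabla M A) (ell_obj D nabla M B)"
proof -
  note Ad = M.submoduleD[OF A] and Bd = M.submoduleD[OF B]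
  note LA = lowest_submoduleD[OF ell_submodule[OF A]] and LB = lowest_submoduleD[OF ell_submodule[OF B]]
  have fh: "f \<in> A \<rightarrow>\<^sub>E B" "\<And>x y. \<lbrakk>x \<in> A; y \<in> A\<rbrakk> \<Longrightarrow> f (x \<oplus>\<^bsub>M\<^esub> y) = f x \<oplus>\<^bsub>M\<^esub> f y"
    "\<And>a x. \<lbrakk>a \<in> carrier D; x \<in> A\<rbrakk> \<Longrightarrow> f (a \<odot>\<^bsub>M\<^esub> x) = a \<odot>\<^bsub>M\<^esub> f x"
    using f unfolding module_homs_def by auto
  have fB: "f x \<in> B" if "x \<in> A" for x using fh(1) that by blast
  have f0: "f \<zero>\<^bsub>M\<^esub> = \<zero>\<^bsub>M\<^esub>" using fh(3)[OF _ Ad(2), of \<zero>] Bd(1)[OF fB[OF Ad(2)]]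
    by (simp add: M.smult_l_null)
  have "f x \<in> ell_obj D nabla M B" if "x \<in> ell_obj D nabla M A" for x
    using that fB fh(3)[OF D_negD, of _ x, symmetric] f0 by (simp add: ell_obj_def)
  moreover have "x \<in> A" if "x \<in> ell_obj D nabla M A" for x using that by (simp add: ell_obj_def)
  moreover have "ell_obj D nabla M A \<subseteq> lowest" "ell_obj D nabla M B \<subseteq> lowest" using LA(1) LB(1) by auto
  ultimately show ?thesis
    unfolding ell_mor_def using fh LA(4,5) by (simp add: ell_homs_iff homogeneous_closed)
qed

text \<open>
  An equation between morphisms of \<open>R\<close>-modules follows by restricting \<open>D\<close>-linear maps to lowest
  weight vectors. An equation between morphisms of \<open>D\<close>-modules compares some
  \<open>delta_mor D M V W f\<close> with a \<open>D\<close>-linear map that agrees with \<open>f\<close> on \<open>V\<close>, so it follows from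
  the uniqueness of the extension.
\<close>

lemma ell_delta_isomorphism:
  assumes gen: "delta_obj D M lowest = carrier M"
  shows "cat_isomorphism (Mod_cat D M) (Mod_cat (R_ring D nabla) (ell_module D nabla M))
    (ell_obj D nabla M) (ell_mor D nabla M) (delta_obj D M) (delta_mor D M)"
proof -
  interpret E: left_module "R_ring D nabla" "ell_module D nabla M"
    by (rule ell_module_is_left_module[OF M.left_module_axioms])
  let ?L = "ell_obj D nabla M" and ?\<delta> = "delta_mor D M" and ?hom = "module_homs D M"
    and ?homR = "module_homs (R_ring D nabla) (ell_module D nabla M)"
  have sub: "submodule (delta_obj D M V) D M" if "lowest_submodule V" for V
    unfolding delta_obj_def by (rule delta_submodule(1)[OF that])
  have LN: "?L N \<subseteq> N" for N by (auto simp: ell_obj_def)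
  have Vd: "V \<subseteq> delta_obj D M V" if "lowest_submodule V" for V
    unfolding delta_obj_def by (rule delta_submodule(2)[OF that])
  interpret D: category "Mod_cat D M" by (rule M.category_Mod_cat)
  interpret R: category "Mod_cat (R_ring D nabla) (ell_module D nabla M)" by (rule E.category_Mod_cat)
  have Did: "restrict (\<lambda>x. x) A \<in> ?hom A A" if "submodule A D M" for A
    using D.Ident_in_Hom that by (simp only: Mod_cat_simps mem_Collect_eq)
  have Dcomp: "compose A g f \<in> ?hom A C"
    if "submodule A D M" "submodule B D M" "submodule C D M" "f \<in> ?hom A B" "g \<in> ?hom B C" for A B C f g
    using D.Comp_in_Hom[of A B C f g] that by (simp only: Mod_cat_simps mem_Collect_eq)
  have Rcomp: "compose A g f \<in> ?homR A C"
    if "lowest_submodule A" "lowest_submodule B" "lowest_submodule C" "f \<in> ?homR A B" "g \<in> ?homR B C"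
    for A B C f g
    using R.Comp_in_Hom[of A B C f g] that by (simp only: Mod_cat_simps mem_Collect_eq)
  have F: "cat_functor (Mod_cat D M) (Mod_cat (R_ring D nabla) (ell_module D nabla M)) ?L (ell_mor D nabla M)"
  proof (intro cat_functor.intro cat_functor_axioms.intro D.category_axioms R.category_axioms,
      simp_all only: Mod_cat_simps mem_Collect_eq)
    show "lowest_submodule (?L A)" if "submodule A D M" for A using that by (rule ell_submodule)
    show "ell_mor D nabla M A B f \<in> ?homR (?L A) (?L B)"
      if "submodule A D M" "submodule B D M" "f \<in> ?hom A B" for A B f using that by (rule ell_mor_hom)
    show "ell_mor D nabla M A A (restrict (\<lambda>x. x) A) = restrict (\<lambda>x. x) (?L A)" for A
      using LN[of A] by (auto simp: ell_mor_def fun_eq_iff)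
    show "ell_mor D nabla M A C (compose A g f) =
        compose (?L A) (ell_mor D nabla M B C g) (ell_mor D nabla M A B f)"
      if "submodule A D M" "submodule B D M" "f \<in> ?hom A B" for A B C f g
    proof -
      have "ell_mor D nabla M A B f \<in> ?L A \<rightarrow>\<^sub>E ?L B"
        using ell_mor_hom[OF that] by (simp add: module_homs_def)
      then have "f x \<in> ?L B" if "x \<in> ?L A" for x
        using that by (auto simp: ell_mor_def)
      then show ?thesis using LN[of A] by (auto simp: ell_mor_def compose_def fun_eq_iff)
    qed
  qed
  have G: "cat_functor (Mod_cat (R_ring D nabla) (ell_module D nabla M)) (Mod_cat D M) (delta_obj D M) ?\<delta>"
  proof (intro cat_functor.intro cat_functor_axioms.intro D.category_axioms R.category_axioms,
      simp_all only: Mod_cat_simps mem_Collect_eq)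
    show "submodule (delta_obj D M V) D M" if "lowest_submodule V" for V using that by (rule sub)
    show "?\<delta> V W f \<in> ?hom (delta_obj D M V) (delta_obj D M W)"
      if "lowest_submodule V" "lowest_submodule W" "f \<in> ?homR V W" for V W f
      using delta_mor_hom[OF that gen] .
    show "?\<delta> V V (restrict (\<lambda>x. x) V) = restrict (\<lambda>x. x) (delta_obj D M V)" if V: "lowest_submodule V" for V
      by (rule delta_mor_unique[OF V V identity_hom[OF V] gen Did[OF sub[OF V]] sub[OF V]])
        (use Vd[OF V] in auto)
    show "?\<delta> V X (compose V g f) = compose (delta_obj D M V) (?\<delta> W X g) (?\<delta> V W f)"
      if V: "lowest_submodule V" and W: "lowest_submodule W" and X: "lowest_submodule X"
        and f: "f \<in> ?homR V W" and g: "g \<in> ?homR W X" for V W X f g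
    proof (rule delta_mor_unique[OF V X Rcomp[OF V W X f g] gen _ sub[OF X]])
      show "compose (delta_obj D M V) (?\<delta> W X g) (?\<delta> V W f) \<in> ?hom (delta_obj D M V) (delta_obj D M X)"
        by (rule Dcomp[OF sub[OF V] sub[OF W] sub[OF X] delta_mor_hom[OF V W f gen] delta_mor_hom[OF W X g gen]])
      show "compose (delta_obj D M V) (?\<delta> W X g) (?\<delta> V W f) v = compose V g f v" if v: "v \<in> V" for v
        using v Vd[OF V] delta_mor_extends[OF V W f gen v]
          delta_mor_extends[OF W X g gen lowest_hom(2)[OF V W f v]] by (auto simp: compose_def)
    qed
  qed
  show ?thesis
  proof (intro cat_isomorphism.intro F G cat_isomorphism_axioms.intro;
      simp only: Mod_cat_simps mem_Collect_eq)
    show "delta_obj D M (?L N) = N" if "submodule N D M" for N using delta_ell[OF gen that] .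
    show "?L (delta_obj D M V) = V" if "lowest_submodule V" for V using ell_delta[OF that] .
    show "?\<delta> (?L A) (?L B) (ell_mor D nabla M A B f) = f"
      if A: "submodule A D M" and B: "submodule B D M" and f: "f \<in> ?hom A B" for A B f
    proof (rule delta_mor_unique[OF ell_submodule[OF A] ell_submodule[OF B] ell_mor_hom[OF A B f] gen _ B])
      show "f \<in> ?hom (delta_obj D M (?L A)) B" using f delta_ell[OF gen A] by simp
    qed (simp add: ell_mor_def)
    show "ell_mor D nabla M (delta_obj D M V) (delta_obj D M W) (?\<delta> V W h) = h"
      if V: "lowest_submodule V" and W: "lowest_submodule W" and h: "h \<in> ?homR V W" for V W h
    proof
      fix x
      show "ell_mor D nabla M (delta_obj D M V) (delta_obj D M W) (?\<delta> V W h) x = h x"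
        using delta_mor_extends[OF V W h gen, of x] PiE_arb[OF lowest_hom(1)[OF V W h], of x]
        by (cases "x \<in> V") (simp_all add: ell_mor_def ell_delta[OF V])
    qed
  qed
qed

end

theorem theorem3p1:
  fixes D :: "(complex, 'd) module" and nabla :: 'd and M :: "('d, 'm) module"
  assumes "graded_complex_algebra D nabla"
    and "left_module D M"
    and "semisimple_module D M"
    and "acts_semisimply D nabla M"
    and "delta_obj D M (ell_obj D nabla M (carrier M)) = carrier M"
  shows "cat_isomorphism
           (Mod_cat D M) (Mod_cat (R_ring D nabla) (ell_module D nabla M))
           (ell_obj D nabla M) (ell_mor D nabla M)
           (delta_obj D M) (delta_mor D M)"
proof -
  interpret semisimple_graded_module D nabla M
    by (intro semisimple_graded_module.intro graded_module.intro
        semisimple_graded_module_axioms.intro assms)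
  show ?thesis by (rule ell_delta_isomorphism[OF assms(5)])
qed

end
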